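(* Let $\mathcal{C}$ be a $d$-uniform clutter without isolated vertices on a finite vertex set $X$, with incidence matrix $A$. Assume that $\mathcal{C}$ has a perfect matching, that $\mathcal{C}$ has the packing property, and that $\alpha_0(\mathcal{C})=2$. If $A$ has rank $r$, then $$\Delta_r\begin{pmatrix}A\\ \mathbf{1}\end{pmatrix}=1,$$ where $\begin{pmatrix}A\\ \mathbf{1}\end{pmatrix}$ is the matrix obtained from $A$ by adding a last row all of whose entries are equal to $1$.
   Context: A clutter with finite vertex set $X$ is a family of subsets of $X$ (edges), none of which is included in another. It is $d$-uniform if all edges have exactly $d$ vertices. A vertex is isolated if it lies in no edge. The incidence matrix is the vertex-edge $\{0,1\}$-matrix whose columns are the characteristic vectors of the edges. A perfect matching is a set of pairwise disjoint edges whose union is $X$. $\alpha_0(\mathcal{C})$ is the minimum size of a vertex cover (a set of vertices meeting every edge), and $\beta_1(\mathcal{C})$ is the maximum number of pairwise disjoint edges. $\mathcal{C}$ has the König property if $\alpha_0(\mathcal{C})=\beta_1(\mathcal{C})$. The edge ideal $I(\mathcal{C})$ is the ideal of the polynomial ring $K[X]$ ($K$ a field) generated by the monomials $\prod_{x\in e}x$, $e$ an edge of $\mathcal{C}$; this gives a one to one correspondence between clutters and square-free monomial ideals. A minor of $\mathcal{C}$ is a clutter corresponding to a proper ideal $I'$ obtained from $I(\mathcal{C})$ by setting some of the variables equal to $0$ and some others equal to $1$ ($\mathcal{C}$ itself is a minor); its edges are the supports of the minimal monomial generators of $I'$. $\mathcal{C}$ has the packing property if all its minors have the König property. For an integral matrix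 $B\neq 0$, $\Delta_r(B)$ is the greatest common divisor of all the nonzero $r\times r$ subdeterminants of $B$. *)

theory Defs
  imports
    "HOL-Library.Poly_Mapping"
    "HOL-Library.Disjoint_Sets"
    "HOL-Algebra.Ideal"
    "Jordan_Normal_Form.DL_Rank_Submatrix"
begin

section \<open>Clutters\<close>

definition clutter :: "'a set \<Rightarrow> 'a set set \<Rightarrow> bool" where
  "clutter X E \<longleftrightarrow> finite X \<and> E \<subseteq> Pow X \<and> (\<forall>e\<in>E. \<forall>f\<in>E. e \<subseteq> f \<longrightarrow> e = f)"

definition uniform :: "nat \<Rightarrow> 'a set set \<Rightarrow> bool" where
  "uniform d E \<longleftrightarrow> (\<forall>e\<in>E. card e = d)"

definition isolated :: "'a set set \<Rightarrow> 'a \<Rightarrow> bool" where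
  "isolated E x \<longleftrightarrow> (\<forall>e\<in>E. x \<notin> e)"

definition perfect_matching :: "'a set \<Rightarrow> 'a set set \<Rightarrow> 'a set set \<Rightarrow> bool" where
  "perfect_matching X E M \<longleftrightarrow> M \<subseteq> E \<and> disjoint M \<and> \<Union>M = X"

definition vertex_cover :: "'a set \<Rightarrow> 'a set set \<Rightarrow> 'a set \<Rightarrow> bool" where
  "vertex_cover X E C \<longleftrightarrow> C \<subseteq> X \<and> (\<forall>e\<in>E. C \<inter> e \<noteq> {})"

text \<open>A vertex cover exists unless the empty set is an edge; in that case the following
  minimum is taken over the empty set and carries no information.\<close>

definition covering_number :: "'a set \<Rightarrow> 'a set set \<Rightarrow> nat" where
  "covering_number X E = Min {card C | C. vertex_cover X E C}"

definition matching_number :: "'a set set \<Rightarrow> nat" where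
  "matching_number E = Max {card M | M. M \<subseteq> E \<and> disjoint M}"

definition Konig_property :: "'a set \<Rightarrow> 'a set set \<Rightarrow> bool" where
  "Konig_property X E \<longleftrightarrow> covering_number X E = matching_number E"


section \<open>Edge ideals and minors\<close>

text \<open>A monomial is its exponent function \<open>'a \<Rightarrow>\<^sub>0 nat\<close>, and a polynomial is a finitely
  supported function from monomials to coefficients. The ring with variables \<open>X\<close> is a
  subring of the one in which all elements of \<open>'a\<close> are variables.\<close>

type_synonym ('a, 'k) mpolynomial = "('a \<Rightarrow>\<^sub>0 nat) \<Rightarrow>\<^sub>0 'k"

definition polynomial_ring :: "'a set \<Rightarrow> ('a, 'k::field) mpolynomial ring" where
  "polynomial_ring X =
    \<lparr>carrier = {p. \<forall>m\<in>Poly_Mapping.keys p. Poly_Mapping.keys m \<subseteq> X},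
     monoid.mult = (*), one = 1, zero = 0, add = (+)\<rparr>"

definition var :: "'a \<Rightarrow> ('a, 'k::field) mpolynomial" where
  "var x = Poly_Mapping.single (Poly_Mapping.single x 1) 1"

definition edge_ideal :: "'a set \<Rightarrow> 'a set set \<Rightarrow> ('a, 'k::field) mpolynomial set" where
  "edge_ideal X E = genideal (polynomial_ring X) ((\<lambda>e. \<Prod>x\<in>e. var x) ` E)"

text \<open>Evaluation of a polynomial at \<open>0\<close> in the variables of \<open>S\<close> and at \<open>1\<close> in those of \<open>T\<close>;
  the other variables are kept.\<close>

definition specialize ::
  "'a set \<Rightarrow> 'a set \<Rightarrow> ('a, 'k::field) mpolynomial \<Rightarrow> ('a, 'k) mpolynomial" where
  "specialize S T p =
    (\<Sum>m\<in>Poly_Mapping.keys p. Poly_Mapping.single 0 (Poly_Mapping.lookup p m) *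
      (\<Prod>x\<in>Poly_Mapping.keys m.
        (if x \<in> S then 0 else if x \<in> T then 1 else var x) ^ Poly_Mapping.lookup m x))"

text \<open>The minimal monomial generators of a monomial ideal are its monomials that are minimal
  with respect to divisibility, i.e. the pointwise order of the exponents.\<close>

definition minimal_monomials :: "('a, 'k::field) mpolynomial set \<Rightarrow> ('a \<Rightarrow>\<^sub>0 nat) set" where
  "minimal_monomials I =
    {m. Poly_Mapping.single m 1 \<in> I \<and>
        (\<forall>m'. Poly_Mapping.single m' 1 \<in> I \<longrightarrow>
          (\<forall>x. Poly_Mapping.lookup m' x \<le> Poly_Mapping.lookup m x) \<longrightarrow> m' = m)}"

text \<open>\<open>F\<close>, on the vertex set \<open>Y\<close> of the remaining variables, is a minor of \<open>E\<close>. The first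
  argument fixes the coefficient field.\<close>

definition minor ::
  "'k::field itself \<Rightarrow> 'a set \<Rightarrow> 'a set set \<Rightarrow> 'a set \<Rightarrow> 'a set set \<Rightarrow> bool" where
  "minor K X E Y F \<longleftrightarrow>
    (\<exists>S T. \<exists>I :: ('a, 'k) mpolynomial set.
      S \<subseteq> X \<and> T \<subseteq> X \<and> S \<inter> T = {} \<and> Y = X - (S \<union> T) \<and>
      I = specialize S T ` edge_ideal X E \<and>
      I \<noteq> carrier (polynomial_ring Y) \<and>
      F = Poly_Mapping.keys ` minimal_monomials I)"

definition packing_property :: "'k::field itself \<Rightarrow> 'a set \<Rightarrow> 'a set set \<Rightarrow> bool" where
  "packing_property K X E \<longleftrightarrow> (\<forall>Y F. minor K X E Y F \<longrightarrow> Konig_property Y F)"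

text \<open>Ideals in the library are ideals of rings, so the generated ideal is meaningful only
  because of the following fact.\<close>

lemma cring_polynomial_ring: "cring (polynomial_ring X :: ('a, 'k::field) mpolynomial ring)"
proof -
  let ?P = "{p :: ('a, 'k) mpolynomial.
    \<forall>m\<in>Poly_Mapping.keys p. Poly_Mapping.keys m \<subseteq> X}"
  have add: "p + q \<in> ?P" if p: "p \<in> ?P" and q: "q \<in> ?P" for p q
  proof -
    have "Poly_Mapping.keys m \<subseteq> X" if "m \<in> Poly_Mapping.keys (p + q)" for m
      using subsetD[OF Poly_Mapping.keys_add that] p q by blast
    then show ?thesis by blast
  qed
  have mult: "p * q \<in> ?P" if p: "p \<in> ?P" and q: "q \<in> ?P" for p q
  proof -
    have "Poly_Mapping.keys m \<subseteq> X" if pq: "m \<in> Poly_Mapping.keys (p * q)" for m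
    proof -
      obtain a b where m: "m = a + b"
        and a: "a \<in> Poly_Mapping.keys p" and b: "b \<in> Poly_Mapping.keys q"
        using subsetD[OF Poly_Mapping.keys_mult pq] by blast
      have "Poly_Mapping.keys a \<subseteq> X" "Poly_Mapping.keys b \<subseteq> X"
        using a b p q by blast+
      then show ?thesis
        unfolding m using Poly_Mapping.keys_add[of a b] by blast
    qed
    then show ?thesis by blast
  qed
  have zero: "0 \<in> ?P" and one: "1 \<in> ?P" by simp_all
  have uminus: "- p \<in> ?P" if "p \<in> ?P" for p using that by simp
  let ?R = "polynomial_ring X :: ('a, 'k) mpolynomial ring"
  have R: "carrier ?R = ?P" "monoid.mult ?R = (*)" "monoid.one ?R = 1"
    "ring.zero ?R = 0" "ring.add ?R = (+)"
    by (simp_all add: polynomial_ring_def)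
  have "abelian_group ?R"
  proof (rule abelian_groupI, unfold R)
    fix p assume "p \<in> ?P"
    then show "\<exists>q\<in>?P. q + p = 0"
      using uminus by (intro bexI[of _ "- p"]) simp_all
  qed (use add zero in \<open>simp_all only: ac_simps add_0_left add_0_right\<close>)
  moreover have "comm_monoid ?R"
    by (rule comm_monoidI, unfold R)
      (use mult one in \<open>simp_all only: ac_simps mult_1_left mult_1_right\<close>)
  ultimately show ?thesis
    by (rule cringI) (simp only: R distrib_right)
qed


section \<open>Matrices\<close>

text \<open>Enumerations \<open>xs\<close> of the vertices and \<open>es\<close> of the edges order the rows and the columns.\<close>

definition incidence_matrix :: "'a list \<Rightarrow> 'a set list \<Rightarrow> int mat" where
  "incidence_matrix xs es =
    mat (length xs) (length es) (\<lambda>(i, j). if xs ! i \<in> es ! j then 1 else 0)"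

definition append_ones_row :: "int mat \<Rightarrow> int mat" where
  "append_ones_row A = A @\<^sub>r mat 1 (dim_col A) (\<lambda>_. 1)"

definition subdeterminants :: "nat \<Rightarrow> int mat \<Rightarrow> int set" where
  "subdeterminants r B = {det (submatrix B I J) | I J.
    I \<subseteq> {..<dim_row B} \<and> J \<subseteq> {..<dim_col B} \<and> card I = r \<and> card J = r}"

definition Delta :: "nat \<Rightarrow> int mat \<Rightarrow> int" where
  "Delta r B = Gcd (subdeterminants r B - {0})"

text \<open>The rank of an integral matrix is its rank over the rationals; the library's rank takes
  the number of rows as an extra argument.\<close>

definition int_mat_rank :: "int mat \<Rightarrow> nat" where
  "int_mat_rank A = vec_space.rank (dim_row A) (map_mat rat_of_int A)"

end

theory Submission
  imports Defs
begin

text \<open>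
  Lehman's argument shows that a clutter with the packing property is ideal: every fractional vertex
  cover dominates a convex combination of vertex covers. Indeed, in a minimal counterexample the
  tight edges at a fractional vertex contain a square regular system, which contradicts the Koenig
  property.

  The perfect matching consists of two edges, so \<open>|X| = 2d\<close>. The constant fractional cover \<open>1 / d\<close> has
  total weight \<open>2 = \<alpha>\<^sub>0\<close>, hence is a convex combination of covers of size 2, each of which meets
  every edge exactly once. So every vertex \<open>v\<close> has an antipode: a vertex contained in exactly the
  edges avoiding \<open>v\<close>.

  Let \<open>I\<close> be a subset of an edge \<open>e\<^sub>1\<close> of the perfect matching, with pairwise distinct rows, and let
  \<open>i\<close> in \<open>I\<close> lie in the fewest edges. Deleting \<open>i\<close> and contracting all vertices except \<open>I\<close> and the
  antipodes of \<open>I - {i}\<close> gives a minor without covers of size 1, so it has two disjoint edges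
  coming from edges \<open>f\<^sub>1\<close> and \<open>f\<^sub>2\<close> of the clutter, and \<open>e\<^sub>1 - f\<^sub>1 - f\<^sub>2\<close> restricts to the unit vector of \<open>i\<close> on
  \<open>I\<close>. Hence the columns restricted to suitable \<open>r\<close> rows of \<open>A\<close> generate \<open>\<int>\<^sup>r\<close>, and by multilinearity
  of the determinant the \<open>r \<times> r\<close> minors on these rows have no common divisor.
\<close>

section \<open>Ideal clutters and Lehman's argument\<close>

text \<open>Gaussian elimination, by induction on the set \<open>F\<close> of equations: a nonzero
  coefficient in a new equation is used to eliminate one of the unknowns in
  \<open>K\<close>.\<close>

lemma homogeneous_system_nontrivial:
  fixes c :: "'k \<Rightarrow> 'f \<Rightarrow> 'a::field"
  assumes "finite F" "finite K" "card F < card K"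
  shows "\<exists>\<alpha>. (\<exists>k\<in>K. \<alpha> k \<noteq> 0) \<and> (\<forall>f\<in>F. (\<Sum>k\<in>K. \<alpha> k * c k f) = 0)"
  using assms
proof (induction F arbitrary: K c rule: finite_induct)
  case empty
  then have "K \<noteq> {}" by auto
  then show ?case by (intro exI[of _ "\<lambda>_. 1"]) auto
next
  case (insert f F)
  show ?case
  proof (cases "\<forall>k\<in>K. c k f = 0")
    case True
    have "card F < card K" using insert.prems insert.hyps by simp
    from insert.IH[OF insert.prems(1) this, of c]
    obtain \<alpha> where "\<exists>k\<in>K. \<alpha> k \<noteq> 0" "\<forall>f\<in>F. (\<Sum>k\<in>K. \<alpha> k * c k f) = 0" by blast
    with True show ?thesis by (intro exI[of _ \<alpha>]) auto
  next
    case False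
    then obtain k0 where k0: "k0 \<in> K" "c k0 f \<noteq> 0" by blast
    let ?K = "K - {k0}"
    \<comment> \<open>These are the coefficients after equation \<open>f\<close> has been solved for
      the unknown \<open>k0\<close> and the result substituted.\<close>
    let ?c = "\<lambda>k g. c k g - c k f / c k0 f * c k0 g"
    have "card F < card ?K" using insert.prems insert.hyps k0 by (simp add: card_Diff_singleton)
    from insert.IH[OF finite_Diff[OF insert.prems(1)] this, of ?c]
    obtain \<alpha> where \<alpha>: "\<exists>k\<in>?K. \<alpha> k \<noteq> 0" "\<forall>g\<in>F. (\<Sum>k\<in>?K. \<alpha> k * ?c k g) = 0" by blast
    define s where "s = (\<Sum>k\<in>?K. \<alpha> k * c k f) / c k0 f"
    define \<beta> where "\<beta> k = (if k = k0 then - s else \<alpha> k)" for k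
    have sum\<beta>: "(\<Sum>k\<in>K. \<beta> k * c k g) = - s * c k0 g + (\<Sum>k\<in>?K. \<alpha> k * c k g)" for g
    proof -
      have "(\<Sum>k\<in>K. \<beta> k * c k g) = \<beta> k0 * c k0 g + (\<Sum>k\<in>?K. \<beta> k * c k g)"
        using insert.prems(1) k0(1) by (rule sum.remove)
      also have "(\<Sum>k\<in>?K. \<beta> k * c k g) = (\<Sum>k\<in>?K. \<alpha> k * c k g)"
        by (rule sum.cong) (auto simp: \<beta>_def)
      finally show ?thesis by (simp add: \<beta>_def)
    qed
    have "(\<Sum>k\<in>K. \<beta> k * c k f) = 0"
      using k0(2) unfolding sum\<beta> s_def by simp
    moreover have "(\<Sum>k\<in>K. \<beta> k * c k g) = 0" if "g \<in> F" for g
    proof -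
      have "(\<Sum>k\<in>?K. \<alpha> k * ?c k g)
          = (\<Sum>k\<in>?K. \<alpha> k * c k g) - (\<Sum>k\<in>?K. \<alpha> k * c k f) / c k0 f * c k0 g"
        by (simp add: sum_subtractf sum_distrib_right sum_divide_distrib right_diff_distrib mult.assoc)
      then show ?thesis using \<alpha>(2) that unfolding sum\<beta> s_def by simp
    qed
    moreover have "\<exists>k\<in>K. \<beta> k \<noteq> 0" using \<alpha>(1) by (auto simp: \<beta>_def)
    ultimately show ?thesis by (intro exI[of _ \<beta>]) auto
  qed
qed

section \<open>Fractional covers and convex combinations of covers\<close>

text \<open>On a finite vertex set no cover is smaller than a matching, so equal sizes certify that
  both are optimal. This form avoids \<open>Min\<close> and \<open>Max\<close> and suits families
  that are not clutters.\<close>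

definition konig :: "'a set \<Rightarrow> 'a set set \<Rightarrow> bool" where
  "konig Y F \<longleftrightarrow> (\<exists>Z M. vertex_cover Y F Z \<and> M \<subseteq> F \<and> disjoint M \<and> card M = card Z)"

definition fractional_cover :: "'a set \<Rightarrow> 'a set set \<Rightarrow> ('a \<Rightarrow> real) \<Rightarrow> bool" where
  "fractional_cover Y F x \<longleftrightarrow> (\<forall>v\<in>Y. 0 \<le> x v) \<and> (\<forall>e\<in>F. 1 \<le> sum x e)"

text \<open>Coefficients of a convex combination of vertex covers; covers are subsets of
  \<open>Y\<close>, so no weight lies outside \<open>Pow Y\<close>.\<close>

definition cover_weights :: "'a set \<Rightarrow> 'a set set \<Rightarrow> ('a set \<Rightarrow> real) \<Rightarrow> bool" where
  "cover_weights Y F l \<longleftrightarrow>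
    (\<forall>b. 0 \<le> l b) \<and> (\<forall>b. l b \<noteq> 0 \<longrightarrow> vertex_cover Y F b) \<and> (\<Sum>b\<in>Pow Y. l b) = 1"

definition load :: "'a set \<Rightarrow> ('a set \<Rightarrow> real) \<Rightarrow> 'a \<Rightarrow> real" where
  "load Y l v = (\<Sum>b\<in>Pow Y. l b * of_bool (v \<in> b))"

definition dominated :: "'a set \<Rightarrow> 'a set set \<Rightarrow> ('a \<Rightarrow> real) \<Rightarrow> bool" where
  "dominated Y F x \<longleftrightarrow> (\<exists>l. cover_weights Y F l \<and> (\<forall>v\<in>Y. load Y l v \<le> x v))"

text \<open>Integrality of the covering polyhedron: the fractional covers are the convex hull of the
  characteristic vectors of covers plus the nonnegative orthant.\<close>

definition ideal_clutter :: "'a set \<Rightarrow> 'a set set \<Rightarrow> bool" where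
  "ideal_clutter Y F \<longleftrightarrow> (\<forall>x. fractional_cover Y F x \<longrightarrow> dominated Y F x)"

text \<open>For \<open>R \<subseteq> Pow Y\<close> this is full column rank of the incidence system
  of \<open>R\<close>: the sums over the members of \<open>R\<close> fix a vector on
  \<open>Y\<close>.\<close>

definition determining :: "'a set \<Rightarrow> 'a set set \<Rightarrow> bool" where
  "determining Y R \<longleftrightarrow> (\<forall>v :: 'a \<Rightarrow> real. (\<forall>e\<in>R. sum v e = 0) \<longrightarrow> (\<forall>j\<in>Y. v j = 0))"

lemma determiningI:
  assumes "\<And>v j. (\<And>e. e \<in> R \<Longrightarrow> sum v e = (0 :: real)) \<Longrightarrow> j \<in> Y \<Longrightarrow> v j = 0"
  shows "determining Y R"
  unfolding determining_def
proof (intro allI impI ballI)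
  fix v :: "'a \<Rightarrow> real" and j assume "\<forall>e\<in>R. sum v e = 0" "j \<in> Y"
  then show "v j = 0" using assms[of v j] by blast
qed

lemma determiningD:
  fixes v :: "'a \<Rightarrow> real"
  assumes "determining Y R" "\<And>e. e \<in> R \<Longrightarrow> sum v e = 0" "j \<in> Y"
  shows "v j = 0"
proof -
  have "\<forall>e\<in>R. sum v e = 0" using assms(2) by blast
  from assms(1)[unfolded determining_def, THEN spec, of v, THEN mp, OF this] assms(3)
  show ?thesis by (rule bspec)
qed

lemma dominated_mono:
  assumes "dominated Y F x" "\<And>v. v \<in> Y \<Longrightarrow> x v \<le> y v"
  shows "dominated Y F y"
  using assms unfolding dominated_def by (meson order_trans)

lemma dominated_convex:
  assumes "dominated Y F x" "dominated Y F y" "0 \<le> s" "s \<le> 1"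
  shows "dominated Y F (\<lambda>v. s * x v + (1 - s) * y v)"
proof -
  from assms obtain l m where l: "cover_weights Y F l" "\<forall>v\<in>Y. load Y l v \<le> x v"
    and m: "cover_weights Y F m" "\<forall>v\<in>Y. load Y m v \<le> y v"
    unfolding dominated_def by blast
  let ?n = "\<lambda>b. s * l b + (1 - s) * m b"
  have ld: "load Y ?n v = s * load Y l v + (1 - s) * load Y m v" for v
    unfolding load_def by (simp add: sum.distrib sum_distrib_left distrib_right mult.assoc)
  have "(\<Sum>b\<in>Pow Y. ?n b) = s * (\<Sum>b\<in>Pow Y. l b) + (1 - s) * (\<Sum>b\<in>Pow Y. m b)"
    by (simp add: sum.distrib sum_distrib_left)
  moreover have "vertex_cover Y F b" if "?n b \<noteq> 0" for b
    using that l(1) m(1) unfolding cover_weights_def by (cases "l b = 0") auto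
  ultimately have "cover_weights Y F ?n"
    using l(1) m(1) assms(3,4) unfolding cover_weights_def by auto
  moreover have "load Y ?n v \<le> s * x v + (1 - s) * y v" if "v \<in> Y" for v
    unfolding ld using l(2) m(2) assms(3,4) that by (intro add_mono mult_left_mono) auto
  ultimately show ?thesis unfolding dominated_def by blast
qed

lemma sum_load:
  assumes "finite Y" "e \<subseteq> Y"
  shows "(\<Sum>v\<in>e. load Y l v) = (\<Sum>b\<in>Pow Y. l b * real (card (b \<inter> e)))"
proof -
  have fe: "finite e" using assms finite_subset by blast
  have "(\<Sum>v\<in>e. load Y l v) = (\<Sum>b\<in>Pow Y. \<Sum>v\<in>e. l b * of_bool (v \<in> b))"
    unfolding load_def by (rule sum.swap)
  also have "\<dots> = (\<Sum>b\<in>Pow Y. l b * real (card (b \<inter> e)))"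
  proof (rule sum.cong[OF refl])
    fix b
    have "(\<Sum>v\<in>e. of_bool (v \<in> b)) = real (card (b \<inter> e))"
      using fe by (simp add: sum_of_bool_eq Int_def conj_commute)
    then show "(\<Sum>v\<in>e. l b * of_bool (v \<in> b)) = l b * real (card (b \<inter> e))"
      by (simp flip: sum_distrib_left)
  qed
  finally show ?thesis .
qed

text \<open>Complementary slackness. Covers of positive weight meet \<open>e\<close> at least once,
  so the load on \<open>e\<close> is at least 1, while \<open>x\<close> allows at most 1; both
  estimates are equalities term by term.\<close>

lemma tight_edge_load:
  assumes Y: "finite Y" and F: "e \<subseteq> Y" "e \<in> F" and l: "cover_weights Y F l"
    and le: "\<And>v. v \<in> e \<Longrightarrow> load Y l v \<le> x v" and tight: "sum x e = 1"
  shows "\<And>b. l b \<noteq> 0 \<Longrightarrow> card (b \<inter> e) = 1"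
    and "\<And>v. v \<in> e \<Longrightarrow> load Y l v = x v"
proof -
  have fe: "finite e" using Y F finite_subset by blast
  have ge: "l b * 1 \<le> l b * real (card (b \<inter> e))" for b
  proof (cases "l b = 0")
    case False
    then have "b \<inter> e \<noteq> {}" using l F unfolding cover_weights_def vertex_cover_def by auto
    then have "card (b \<inter> e) \<ge> 1" using fe by (simp add: Suc_leI card_gt_0_iff)
    then show ?thesis using l unfolding cover_weights_def by (intro mult_left_mono) auto
  qed simp
  have "1 \<le> (\<Sum>b\<in>Pow Y. l b * real (card (b \<inter> e)))"
    using sum_mono[of "Pow Y" "\<lambda>b. l b * 1", OF ge] l unfolding cover_weights_def by simp
  also have "\<dots> = (\<Sum>v\<in>e. load Y l v)" using sum_load[OF Y F(1)] by simp
  finally have 1: "1 \<le> (\<Sum>v\<in>e. load Y l v)" .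
  have 2: "(\<Sum>v\<in>e. load Y l v) \<le> sum x e" by (rule sum_mono) (rule le)
  have eq: "(\<Sum>v\<in>e. load Y l v) = sum x e" using 1 2 tight by linarith
  show "load Y l v = x v" if "v \<in> e" for v
    using sum_mono_inv[OF eq le that fe] .
  have "(\<Sum>b\<in>Pow Y. l b * 1) = (\<Sum>b\<in>Pow Y. l b * real (card (b \<inter> e)))"
    using eq tight sum_load[OF Y F(1), of l] l unfolding cover_weights_def by simp
  from sum_mono_inv[OF this ge] Y
  have "l b * 1 = l b * real (card (b \<inter> e))" if "b \<in> Pow Y" for b using that by blast
  then show "card (b \<inter> e) = 1" if "l b \<noteq> 0" for b
    using that l unfolding cover_weights_def vertex_cover_def by (metis PowI mult_cancel_left of_nat_eq_1_iff)
qed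

section \<open>Passing to the deletion or contraction of a vertex\<close>

text \<open>A coordinate 0 can be contracted: the edge sums do not change, and a cover of the
  contraction is a cover of \<open>F\<close> avoiding \<open>j\<close>, so the load at
  \<open>j\<close> is 0.\<close>

lemma dominated_if_contraction:
  assumes "finite Y" "F \<subseteq> Pow Y" "j \<in> Y" "ideal_clutter (Y - {j}) ((\<lambda>f. f - {j}) ` F)"
    and x: "fractional_cover Y F x" "x j = 0"
  shows "dominated Y F x"
proof -
  let ?Y = "Y - {j}" and ?F = "(\<lambda>f. f - {j}) ` F"
  have "sum x (e - {j}) = sum x e" if "e \<in> F" for e
    using x(2) assms(1,2) that by (subst sum_diff1) (auto intro: finite_subset)
  then have "fractional_cover ?Y ?F x"
    using x(1) unfolding fractional_cover_def by auto
  then obtain l where l: "cover_weights ?Y ?F l" "\<forall>v\<in>?Y. load ?Y l v \<le> x v"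
    using assms(4) unfolding ideal_clutter_def dominated_def by blast
  have l0: "b \<subseteq> ?Y \<and> vertex_cover Y F b" if "l b \<noteq> 0" for b
    using l(1) that unfolding cover_weights_def vertex_cover_def by fastforce
  have s: "(\<Sum>b\<in>Pow Y. l b * g b) = (\<Sum>b\<in>Pow ?Y. l b * g b)" for g
    using assms(1) by (intro sum.mono_neutral_right) (auto dest: l0)
  have "cover_weights Y F l"
    using l(1) l0 s[of "\<lambda>_. 1"] unfolding cover_weights_def by auto
  moreover have "load Y l v \<le> x v" if "v \<in> Y" for v
  proof (cases "v = j")
    case True
    have "load Y l j = 0" unfolding load_def using l0 by (intro sum.neutral) auto
    then show ?thesis using True x(2) by simp
  next
    case False
    then show ?thesis using l(2) that s[of "\<lambda>b. of_bool (v \<in> b)"] unfolding load_def by auto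
  qed
  ultimately show ?thesis unfolding dominated_def by blast
qed

text \<open>Adding \<open>j\<close> to the covers of the deletion of \<open>j\<close> gives covers
  of \<open>F\<close>. Hence \<open>x\<close> becomes dominated once its value at \<open>j\<close>
  is raised to 1.\<close>

lemma raised_weights:
  assumes "finite Y" "F \<subseteq> Pow Y" "j \<in> Y" "ideal_clutter (Y - {j}) {f \<in> F. j \<notin> f}"
    and x: "fractional_cover Y F x"
  obtains l where "cover_weights Y F l" "\<And>b. l b \<noteq> 0 \<Longrightarrow> j \<in> b"
    "\<And>v. v \<in> Y - {j} \<Longrightarrow> load Y l v \<le> x v" "load Y l j = 1"
proof -
  let ?Y = "Y - {j}" and ?F = "{f \<in> F. j \<notin> f}"
  have "fractional_cover ?Y ?F x"
    using x unfolding fractional_cover_def by auto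
  then obtain l where l: "cover_weights ?Y ?F l" "\<forall>v\<in>?Y. load ?Y l v \<le> x v"
    using assms(4) unfolding ideal_clutter_def dominated_def by blast
  define m where "m b = (if j \<in> b then l (b - {j}) else 0)" for b
  have s: "(\<Sum>b\<in>Pow Y. m b * g b) = (\<Sum>b\<in>Pow ?Y. l b * g (insert j b))" for g
  proof -
    have "(\<Sum>b\<in>Pow Y. m b * g b) = (\<Sum>b\<in>{b \<in> Pow Y. j \<in> b}. m b * g b)"
      using assms(1) by (intro sum.mono_neutral_right) (auto simp: m_def)
    also have "\<dots> = (\<Sum>b\<in>Pow ?Y. l b * g (insert j b))"
      using assms(3)
      by (intro sum.reindex_bij_witness[of _ "insert j" "\<lambda>b. b - {j}"])
        (auto simp: m_def insert_absorb)
    finally show ?thesis .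
  qed
  show thesis
  proof
    have sm: "(\<Sum>b\<in>Pow Y. m b) = 1"
      using s[of "\<lambda>_. 1"] l(1) unfolding cover_weights_def by simp
    have vc: "vertex_cover Y F b" if "m b \<noteq> 0" for b
    proof -
      have b: "j \<in> b" "l (b - {j}) \<noteq> 0" using that by (auto simp: m_def split: if_splits)
      then have v: "vertex_cover ?Y ?F (b - {j})" using l(1) unfolding cover_weights_def by blast
      show ?thesis unfolding vertex_cover_def
      proof (intro conjI ballI)
        show "b \<subseteq> Y" using v assms(3) unfolding vertex_cover_def by auto
        fix e assume "e \<in> F"
        then show "b \<inter> e \<noteq> {}"
          using v b(1) unfolding vertex_cover_def by (cases "j \<in> e") auto
      qed
    qed
    show "cover_weights Y F m"
      using sm vc l(1) unfolding cover_weights_def by (auto simp: m_def)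
    show "j \<in> b" if "m b \<noteq> 0" for b using that by (auto simp: m_def split: if_splits)
    show "load Y m v \<le> x v" if "v \<in> Y - {j}" for v
      using l(2) that s[of "\<lambda>b. of_bool (v \<in> b)"] unfolding load_def by auto
    show "load Y m j = 1"
      using s[of "\<lambda>b. of_bool (j \<in> b)"] l(1) unfolding load_def cover_weights_def by simp
  qed
qed

section \<open>Extreme points of the covering polyhedron\<close>

text \<open>A ratio test: moving from \<open>x\<close> along \<open>v\<close> keeps the tight edges
  tight, and the negative entry at \<open>i\<close> forces a first moment at which a coordinate
  vanishes or a slack edge becomes tight.\<close>

lemma push_to_boundary:
  assumes Y: "finite Y" and F: "F \<subseteq> Pow Y" and x: "fractional_cover Y F x"
    and pos: "\<And>j. j \<in> Y \<Longrightarrow> 0 < x j"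
    and v: "\<And>e. e \<in> F \<Longrightarrow> sum x e = 1 \<Longrightarrow> sum v e = 0" and neg: "i \<in> Y" "v i < 0"
  obtains t where "0 < t" "fractional_cover Y F (\<lambda>j. x j + t * v j)"
    "(\<exists>j\<in>Y. x j + t * v j = 0) \<or>
      {e \<in> F. sum x e = 1} \<subset> {e \<in> F. sum (\<lambda>j. x j + t * v j) e = 1}"
proof -
  have fF: "finite F" using Y F finite_subset by blast
  \<comment> \<open>The times at which decreasing coordinates reach 0 and decreasing edge sums reach
    1; the least of them is the step length.\<close>
  define S where "S = (\<lambda>j. x j / - v j) ` {j \<in> Y. v j < 0} \<union>
    (\<lambda>e. (sum x e - 1) / - sum v e) ` {e \<in> F. sum v e < 0}"
  have S: "finite S" "S \<noteq> {}" using Y fF neg unfolding S_def by auto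
  define t where "t = Min S"
  have tS: "t \<in> S" and tle: "\<And>s. s \<in> S \<Longrightarrow> t \<le> s" unfolding t_def using S by auto
  have xge: "1 < sum x e" if "e \<in> F" "sum v e < 0" for e
    using x v[of e] that unfolding fractional_cover_def by (metis less_eq_real_def less_irrefl)
  have "0 < s" if "s \<in> S" for s
    using that pos xge unfolding S_def by (auto intro!: divide_pos_pos divide_pos_neg simp: divide_less_0_iff)
  then have t: "0 < t" using tS by blast
  have sum_eq: "sum (\<lambda>j. x j + t * v j) e = sum x e + t * sum v e" for e
    by (simp add: sum.distrib sum_distrib_left)
  have nonneg: "0 \<le> x j + t * v j" if "j \<in> Y" for j
  proof (cases "v j < 0")
    case True
    then have "t \<le> x j / - v j" using that by (intro tle) (auto simp: S_def)
    then show ?thesis using True by (simp add: field_simps)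
  next
    case False
    then show ?thesis using t pos[OF that] by (simp add: add_nonneg_nonneg less_imp_le)
  qed
  have ge1: "1 \<le> sum x e + t * sum v e" if "e \<in> F" for e
  proof (cases "sum v e < 0")
    case True
    then have "t \<le> (sum x e - 1) / - sum v e" using that by (intro tle) (auto simp: S_def)
    then show ?thesis using True by (simp add: field_simps)
  next
    case False
    then have "0 \<le> t * sum v e" using t by simp
    then show ?thesis using x that unfolding fractional_cover_def by force
  qed
  have "(\<exists>j\<in>Y. x j + t * v j = 0) \<or> (\<exists>e\<in>F. sum v e < 0 \<and> sum x e + t * sum v e = 1)"
    using tS unfolding S_def by (auto simp: field_simps)
  then have "(\<exists>j\<in>Y. x j + t * v j = 0) \<or>
      {e \<in> F. sum x e = 1} \<subset> {e \<in> F. sum (\<lambda>j. x j + t * v j) e = 1}"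
  proof (elim disjE)
    assume "\<exists>e\<in>F. sum v e < 0 \<and> sum x e + t * sum v e = 1"
    then obtain e where e: "e \<in> F" "sum v e < 0" "sum x e + t * sum v e = 1" by blast
    have "{e \<in> F. sum x e = 1} \<subseteq> {e \<in> F. sum (\<lambda>j. x j + t * v j) e = 1}"
      unfolding sum_eq using v by auto
    moreover have "e \<in> {e \<in> F. sum (\<lambda>j. x j + t * v j) e = 1}" "e \<notin> {e \<in> F. sum x e = 1}"
      unfolding sum_eq using e v by auto
    ultimately show ?thesis by blast
  qed simp
  moreover have "fractional_cover Y F (\<lambda>j. x j + t * v j)"
    unfolding fractional_cover_def sum_eq using nonneg ge1 by simp
  ultimately show thesis using that t by blast
qed

text \<open>Among the undominated fractional covers take one with the most tight edges. If
  \<open>v\<close> has sum 0 on these edges and is nonzero on \<open>Y\<close>, moving along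
  \<open>v\<close> and \<open>- v\<close> leads to dominated points, and \<open>x\<close> lies
  between them or above one of them.\<close>

lemma extreme_counterexample:
  fixes F :: "'a set set"
  assumes Y: "finite Y" and F: "F \<subseteq> Pow Y" and bad: "\<not> ideal_clutter Y F"
    and zero: "\<And>x j. fractional_cover Y F x \<Longrightarrow> j \<in> Y \<Longrightarrow> x j = 0 \<Longrightarrow> dominated Y F x"
  obtains x where "fractional_cover Y F x" "\<not> dominated Y F x"
    "determining Y {e \<in> F. sum x e = 1}"
proof -
  have fF: "finite F" using Y F finite_subset by blast
  let ?P = "\<lambda>x. fractional_cover Y F x \<and> \<not> dominated Y F x"
  let ?m = "\<lambda>x. card {e \<in> F. sum x e = 1}"
  obtain x0 where "?P x0" using bad unfolding ideal_clutter_def by blast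
  moreover have "\<forall>x. ?P x \<longrightarrow> ?m x < Suc (card F)"
    using fF by (auto intro!: card_mono simp: less_Suc_eq_le)
  ultimately obtain x where x: "?P x" and mx: "\<And>y. ?P y \<Longrightarrow> ?m y \<le> ?m x"
    using ex_has_greatest_nat[of ?P x0 ?m "Suc (card F)"] by blast
  have pos: "0 < x j" if "j \<in> Y" for j
    using x zero[of x j] that unfolding fractional_cover_def by (metis order_le_less)
  \<comment> \<open>The boundary point has a zero coordinate or more tight edges than
    \<open>x\<close>, and is dominated in either case.\<close>
  have push: "\<exists>t>0. dominated Y F (\<lambda>j. x j + t * v j)"
    if v: "\<And>e. e \<in> F \<Longrightarrow> sum x e = 1 \<Longrightarrow> sum v e = 0" and neg: "\<exists>i\<in>Y. v i < 0" for v
  proof -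
    obtain i where i: "i \<in> Y" "v i < 0" using neg by blast
    have fx: "fractional_cover Y F x" using x by blast
    obtain t where t: "0 < t" "fractional_cover Y F (\<lambda>j. x j + t * v j)"
      "(\<exists>j\<in>Y. x j + t * v j = 0) \<or>
        {e \<in> F. sum x e = 1} \<subset> {e \<in> F. sum (\<lambda>j. x j + t * v j) e = 1}"
      using push_to_boundary[OF Y F fx pos v i] .
    from t(3) have "dominated Y F (\<lambda>j. x j + t * v j)"
    proof
      assume "\<exists>j\<in>Y. x j + t * v j = 0"
      then show ?thesis using zero[OF t(2)] by blast
    next
      assume "{e \<in> F. sum x e = 1} \<subset> {e \<in> F. sum (\<lambda>j. x j + t * v j) e = 1}"
      then have "?m x < ?m (\<lambda>j. x j + t * v j)" using fF by (intro psubset_card_mono) auto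
      then show ?thesis using mx[of "\<lambda>j. x j + t * v j"] t(2) by fastforce
    qed
    with t(1) show ?thesis by blast
  qed
  have nn: "\<forall>i\<in>Y. 0 \<le> v i"
    if v: "\<And>e. e \<in> F \<Longrightarrow> sum x e = 1 \<Longrightarrow> sum v e = 0" for v :: "'a \<Rightarrow> real"
  proof (rule ccontr)
    assume "\<not> ?thesis"
    then have neg: "\<exists>i\<in>Y. v i < 0" by force
    obtain t where t: "t > 0" "dominated Y F (\<lambda>j. x j + t * v j)" using push[OF v neg] by blast
    show False
    proof (cases "\<exists>i\<in>Y. - v i < 0")
      case True
      have "sum (\<lambda>i. - v i) e = 0" if "e \<in> F" "sum x e = 1" for e
        using v that by (simp add: sum_negf)
      then obtain s where s: "s > 0" "dominated Y F (\<lambda>j. x j + s * - v j)"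
        using push[of "\<lambda>i. - v i"] True by blast
      \<comment> \<open>The weights \<open>s / (s + t)\<close> and \<open>t / (s + t)\<close> make
        the displacements \<open>t * v j\<close> and \<open>- s * v j\<close> cancel.\<close>
      have "dominated Y F
          (\<lambda>j. s / (s + t) * (x j + t * v j) + (1 - s / (s + t)) * (x j + s * - v j))"
        using s t by (intro dominated_convex) (auto simp: field_simps)
      moreover have "s / (s + t) * (x j + t * v j) + (1 - s / (s + t)) * (x j + s * - v j) = x j" for j
      proof -
        have "1 - s / (s + t) = t / (s + t)" using s t by (simp add: field_simps)
        then have "s / (s + t) * (x j + t * v j) + (1 - s / (s + t)) * (x j + s * - v j)
            = (s * (x j + t * v j) + t * (x j + s * - v j)) / (s + t)"
          by (simp add: add_divide_distrib)
        also have "\<dots> = ((s + t) * x j) / (s + t)" by (simp add: algebra_simps)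
        finally show ?thesis using s t by simp
      qed
      ultimately show False using x by simp
    next
      case False
      \<comment> \<open>Here \<open>v\<close> is nowhere positive on \<open>Y\<close>, so
        \<open>x\<close> lies above the dominated point.\<close>
      have "dominated Y F x"
        using t(2) by (rule dominated_mono) (use False t(1) in \<open>auto simp: mult_le_0_iff not_less\<close>)
      then show False using x by simp
    qed
  qed
  show thesis
  proof (rule that)
    show "fractional_cover Y F x" "\<not> dominated Y F x" using x by auto
    show "determining Y {e \<in> F. sum x e = 1}"
    proof (rule determiningI)
      fix v :: "'a \<Rightarrow> real" and j
      assume "\<And>e. e \<in> {e \<in> F. sum x e = 1} \<Longrightarrow> sum v e = 0" and j: "j \<in> Y"
      then have v: "sum v e = 0" if "e \<in> F" "sum x e = 1" for e using that by blast
      have "sum (\<lambda>i. - v i) e = 0" if "e \<in> F" "sum x e = 1" for e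
        using v that by (simp add: sum_negf)
      from nn[OF this] nn[OF v] j show "v j = 0" by force
    qed
  qed
qed

text \<open>Extraction of a basis: a determining subfamily of least size has \<open>card Y\<close>
  members. With fewer there is a nonzero solution on \<open>Y\<close>; with more there would be too
  many linearly independent vectors on \<open>Y\<close>.\<close>

lemma determining_subfamily:
  fixes T :: "'a set set"
  assumes Y: "finite Y" and T: "T \<subseteq> Pow Y" and det: "determining Y T"
  obtains R where "R \<subseteq> T" "card R = card Y" "determining Y R"
proof -
  let ?P = "\<lambda>R. R \<subseteq> T \<and> determining Y R"
  obtain R where R: "?P R" and mn: "\<And>R'. ?P R' \<Longrightarrow> card R \<le> card R'"
    using ex_has_least_nat[of ?P T card] det by auto
  then have RT: "R \<subseteq> T" and detR: "determining Y R" by auto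
  have fT: "finite T" using Y T finite_subset by blast
  then have fR: "finite R" using RT finite_subset by blast
  have sub: "e \<subseteq> Y" if "e \<in> R" for e using RT T that by blast
  have "\<not> card R < card Y"
  proof
    assume "card R < card Y"
    from homogeneous_system_nontrivial[OF fR Y this, of "\<lambda>k e. of_bool (k \<in> e) :: real"]
    obtain a :: "'a \<Rightarrow> real" where a: "\<exists>k\<in>Y. a k \<noteq> 0" "\<forall>e\<in>R. (\<Sum>k\<in>Y. a k * of_bool (k \<in> e)) = 0"
      by blast
    have "sum a e = 0" if "e \<in> R" for e
    proof -
      have "(\<Sum>k\<in>Y. a k * of_bool (k \<in> e)) = (\<Sum>k\<in>Y. if k \<in> e then a k else 0)"
        by (intro sum.cong) auto
      also have "\<dots> = sum a (Y \<inter> e)" by (rule sum.inter_restrict[OF Y, symmetric])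
      finally show ?thesis using a(2) that sub[OF that] by (simp add: Int_absorb1)
    qed
    from determiningD[OF detR this] show False using a(1) by blast
  qed
  moreover have "\<not> card Y < card R"
  proof
    assume lt: "card Y < card R"
    \<comment> \<open>Minimality gives, for each \<open>f\<close>, a vector that has sum 0 on all
      members except \<open>f\<close>. These vectors form a dual system to \<open>R\<close> and are
      therefore independent.\<close>
    have "\<exists>v :: 'a \<Rightarrow> real. (\<forall>g\<in>R - {f}. sum v g = 0) \<and> sum v f \<noteq> 0" if f: "f \<in> R" for f
    proof -
      have "card (R - {f}) < card R" using fR f by (meson card_Diff1_less)
      then have "\<not> determining Y (R - {f})" using mn[of "R - {f}"] RT by auto
      then obtain v :: "'a \<Rightarrow> real" where v: "\<forall>g\<in>R - {f}. sum v g = 0" "\<exists>j\<in>Y. v j \<noteq> 0"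
        unfolding determining_def by blast
      have "sum v f \<noteq> 0"
      proof
        assume "sum v f = 0"
        then have "sum v e = 0" if "e \<in> R" for e using v(1) that by blast
        from determiningD[OF detR this] show False using v(2) by blast
      qed
      then show ?thesis using v(1) by blast
    qed
    then have "\<forall>f\<in>R. \<exists>v :: 'a \<Rightarrow> real. (\<forall>g\<in>R - {f}. sum v g = 0) \<and> sum v f \<noteq> 0"
      by (intro ballI)
    from bchoice[OF this] obtain w :: "'a set \<Rightarrow> 'a \<Rightarrow> real"
      where "\<forall>f\<in>R. (\<forall>g\<in>R - {f}. sum (w f) g = 0) \<and> sum (w f) f \<noteq> 0" ..
    then have w: "(\<forall>g\<in>R - {f}. sum (w f) g = 0) \<and> sum (w f) f \<noteq> 0" if "f \<in> R" for f
      using that by blast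
    from homogeneous_system_nontrivial[OF Y fR lt, of w]
    obtain a where a: "\<exists>f\<in>R. a f \<noteq> 0" "\<forall>y\<in>Y. (\<Sum>f\<in>R. a f * w f y) = 0" by blast
    have "a g = 0" if g: "g \<in> R" for g
    proof -
      have "0 = (\<Sum>y\<in>g. \<Sum>f\<in>R. a f * w f y)"
        using a(2) sub[OF g] by (intro sum.neutral[symmetric]) blast
      also have "\<dots> = (\<Sum>f\<in>R. a f * sum (w f) g)"
        by (subst sum.swap) (simp add: sum_distrib_left)
      also have "\<dots> = a g * sum (w g) g + (\<Sum>f\<in>R - {g}. a f * sum (w f) g)"
        using fR g by (rule sum.remove)
      also have "(\<Sum>f\<in>R - {g}. a f * sum (w f) g) = 0"
        using w g by (intro sum.neutral) auto
      finally show ?thesis using w[OF g] by simp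
    qed
    then show False using a(1) by blast
  qed
  ultimately have "card R = card Y" by simp
  with RT show thesis using detR by (rule that)
qed

section \<open>Regular systems of tight edges\<close>

text \<open>For each \<open>k\<close> in \<open>e\<close> take a cover of positive weight through
  \<open>k\<close>; by slackness it meets every member of \<open>R\<close> avoiding \<open>j\<close>
  exactly once, so its vector minus \<open>x\<close> has sum 0 there. If fewer than
  \<open>card e\<close> members contain \<open>j\<close>, a nontrivial combination of these
  differences has sum 0 on them too and thus vanishes on \<open>Y\<close>. Its values at
  \<open>j\<close> and on \<open>e\<close> then force all coefficients to be 0.\<close>

lemma counterexample_degree:
  assumes Y: "finite Y" and F: "F \<subseteq> Pow Y"
    and R: "R \<subseteq> F" "\<And>e. e \<in> R \<Longrightarrow> sum x e = 1"
    and det: "determining Y R"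
    and pos: "\<And>j. j \<in> Y \<Longrightarrow> 0 < x j" and lt1: "x j < 1"
    and l: "cover_weights Y F l" "\<And>b. l b \<noteq> 0 \<Longrightarrow> j \<in> b"
    and le: "\<And>v. v \<in> Y - {j} \<Longrightarrow> load Y l v \<le> x v"
    and e: "e \<in> R" "j \<in> Y" "j \<notin> e"
  shows "card e \<le> card {f \<in> R. j \<in> f}"
proof (rule ccontr)
  assume "\<not> ?thesis"
  then have lt: "card {f \<in> R. j \<in> f} < card e" by simp
  have fR: "finite R" using Y F R(1) finite_subset by (metis finite_Pow_iff)
  have sub: "f \<subseteq> Y" if "f \<in> R" for f using R F that by blast
  have fe: "finite f" if "f \<in> R" for f using Y sub[OF that] finite_subset by blast
  have le': "load Y l v \<le> x v" if "f \<in> R" "j \<notin> f" "v \<in> f" for f v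
    by (rule le) (use sub that in blast)
  have one: "card (b \<inter> f) = 1" if "l b \<noteq> 0" "f \<in> R" "j \<notin> f" for b f
    by (rule tight_edge_load(1)[OF Y sub[OF that(2)] subsetD[OF R(1) that(2)] l(1)
      le'[OF that(2,3)] R(2)[OF that(2)] that(1)])
  have "\<exists>b. l b \<noteq> 0 \<and> k \<in> b" if k: "k \<in> e" for k
  proof -
    have "load Y l k = x k"
      by (rule tight_edge_load(2)[OF Y sub[OF e(1)] subsetD[OF R(1) e(1)] l(1)
        le'[OF e(1,3)] R(2)[OF e(1)] k])
    then have "load Y l k \<noteq> 0" using pos[of k] subsetD[OF sub[OF e(1)] k] by simp
    then obtain b where "l b * of_bool (k \<in> b) \<noteq> 0"
      unfolding load_def by (rule sum.not_neutral_contains_not_neutral)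
    then show ?thesis by auto
  qed
  then obtain B where B: "\<And>k. k \<in> e \<Longrightarrow> l (B k) \<noteq> 0 \<and> k \<in> B k" by metis
  have Be: "y \<in> B k \<longleftrightarrow> y = k" if "k \<in> e" "y \<in> e" for k y
  proof -
    have "card (B k \<inter> e) = 1" using one[OF _ e(1,3)] B[OF that(1)] by blast
    then obtain z where "B k \<inter> e = {z}" by (auto simp: card_1_singleton_iff)
    then show ?thesis using B[OF that(1)] that by (metis Int_iff singletonD)
  qed
  \<comment> \<open>One unknown for each vertex of \<open>e\<close>, one equation for each member of
    \<open>R\<close> through \<open>j\<close>.\<close>
  from homogeneous_system_nontrivial[OF _ fe[OF e(1)] lt, of "\<lambda>k f. real (card (B k \<inter> f)) - 1"] fR
  obtain a where a: "\<exists>k\<in>e. a k \<noteq> 0"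
    "\<And>f. f \<in> R \<Longrightarrow> j \<in> f \<Longrightarrow> (\<Sum>k\<in>e. a k * (real (card (B k \<inter> f)) - 1)) = 0" by auto
  define v where "v y = (\<Sum>k\<in>e. a k * (of_bool (y \<in> B k) - x y))" for y
  have v0: "v y = 0" if "y \<in> Y" for y
  proof (rule determiningD[OF det _ that])
    fix f assume f: "f \<in> R"
    have "sum v f = (\<Sum>k\<in>e. a k * (\<Sum>y\<in>f. of_bool (y \<in> B k) - x y))"
      unfolding v_def by (subst sum.swap) (simp add: sum_distrib_left)
    also have "\<dots> = (\<Sum>k\<in>e. a k * (real (card (B k \<inter> f)) - 1))"
      using fe[OF f] R(2)[OF f]
      by (simp add: sum_subtractf sum_of_bool_eq Int_def conj_commute)
    also have "\<dots> = 0"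
    proof (cases "j \<in> f")
      case False
      then show ?thesis using one B f by (intro sum.neutral) auto
    qed (use a(2) f in blast)
    finally show "sum v f = 0" .
  qed
  \<comment> \<open>All chosen covers contain \<open>j\<close> and \<open>x j < 1\<close>, so the
    value of \<open>v\<close> at \<open>j\<close> shows that the coefficients add up to 0.\<close>
  have s0: "sum a e = 0"
  proof -
    have "v j = (\<Sum>k\<in>e. a k * (1 - x j))"
      unfolding v_def using B l(2) by (intro sum.cong) auto
    then show ?thesis using v0[OF e(2)] lt1 by (simp flip: sum_distrib_right)
  qed
  have "a y = 0" if y: "y \<in> e" for y
  proof -
    have "v y = (\<Sum>k\<in>e. a k * (of_bool (y = k) - x y))"
      unfolding v_def using Be y by (intro sum.cong) auto
    also have "\<dots> = a y - sum a e * x y"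
      using fe[OF e(1)] y
      by (simp add: right_diff_distrib sum_subtractf sum_distrib_right)
    finally show ?thesis using v0[OF subsetD[OF sub[OF e(1)] y]] s0 by simp
  qed
  then show False using a(1) by blast
qed

text \<open>Double counting of nonincident pairs \<open>(e, j)\<close>, as in the de Bruijn-Erdos
  theorem. The weights \<open>1 / (n - card e)\<close> and \<open>1 / (n - D j)\<close> both have
  total \<open>n\<close>, and the degree inequality compares them pair by pair, so they
  agree.\<close>

lemma bipartite_degrees_equal:
  assumes Y: "finite Y" and R: "finite R" "R \<subseteq> Pow Y" "card R = card Y"
    and le: "\<And>e j. e \<in> R \<Longrightarrow> j \<in> Y - e \<Longrightarrow> card e \<le> card {f \<in> R. j \<in> f}"
    and full: "\<And>e. e \<in> R \<Longrightarrow> e \<noteq> Y" "\<And>j. j \<in> Y \<Longrightarrow> \<exists>e\<in>R. j \<notin> e"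
    and e: "e \<in> R" "j \<in> Y - e"
  shows "card e = card {f \<in> R. j \<in> f}"
proof -
  define n where "n = card Y"
  define D where "D j = card {f \<in> R. j \<in> f}" for j
  define N where "N = (SIGMA e:R. Y - e)"
  have fN: "finite N" using Y R unfolding N_def by auto
  have c: "card (Y - e) = n - card e" "card e < n" if "e \<in> R" for e
  proof -
    have "e \<subset> Y" using R(2) full(1) that by blast
    then show "card e < n" unfolding n_def using Y by (rule psubset_card_mono[rotated])
    show "card (Y - e) = n - card e" unfolding n_def using Y \<open>e \<subset> Y\<close>
      by (intro card_Diff_subset) (auto intro: finite_subset)
  qed
  have d: "card {f \<in> R. j \<notin> f} = n - D j" "D j < n" if "j \<in> Y" for j
  proof -
    have "{f \<in> R. j \<notin> f} = R - {f \<in> R. j \<in> f}" by blast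
    then show "card {f \<in> R. j \<notin> f} = n - D j" unfolding D_def n_def R(3)[symmetric]
      using R(1) by (simp add: card_Diff_subset)
    have "{f \<in> R. j \<in> f} \<subset> R" using full(2)[OF that] by blast
    then show "D j < n" unfolding D_def n_def R(3)[symmetric] using R(1) by (rule psubset_card_mono[rotated])
  qed
  have "(\<Sum>(e, j)\<in>N. 1 / real (n - card e)) = (\<Sum>e\<in>R. \<Sum>j\<in>Y - e. 1 / real (n - card e))"
    unfolding N_def by (rule sum.Sigma[symmetric]) (use Y R in auto)
  also have "\<dots> = (\<Sum>e\<in>R. 1)"
  proof (rule sum.cong[OF refl])
    fix e assume "e \<in> R"
    then show "(\<Sum>j\<in>Y - e. 1 / real (n - card e)) = 1"
      using c[of e] by simp
  qed
  finally have 1: "(\<Sum>(e, j)\<in>N. 1 / real (n - card e)) = n" using R(3) by (simp add: n_def)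
  have "(\<Sum>(e, j)\<in>N. 1 / real (n - D j)) = (\<Sum>(j, e)\<in>(SIGMA j:Y. {f \<in> R. j \<notin> f}). 1 / real (n - D j))"
    unfolding N_def by (rule sum.reindex_bij_witness[of _ prod.swap prod.swap]) auto
  also have "\<dots> = (\<Sum>j\<in>Y. \<Sum>e\<in>{f \<in> R. j \<notin> f}. 1 / real (n - D j))"
    by (rule sum.Sigma[symmetric]) (use Y R in auto)
  also have "\<dots> = (\<Sum>j\<in>Y. 1)"
  proof (rule sum.cong[OF refl])
    fix j assume "j \<in> Y"
    then show "(\<Sum>e\<in>{f \<in> R. j \<notin> f}. 1 / real (n - D j)) = 1"
      using d[of j] by simp
  qed
  finally have 2: "(\<Sum>(e, j)\<in>N. 1 / real (n - D j)) = n" by (simp add: n_def)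
  have "(\<lambda>(e, j). 1 / real (n - card e)) (e, j) = (\<lambda>(e, j). 1 / real (n - D j)) (e, j)"
  proof (rule sum_mono_inv[OF trans[OF 1 2[symmetric]] _ _ fN])
    show "(e, j) \<in> N" using e by (simp add: N_def)
    fix p assume "p \<in> N"
    then obtain e j where p: "p = (e, j)" "e \<in> R" "j \<in> Y - e" by (auto simp: N_def)
    have "n - D j \<le> n - card e" "0 < n - D j"
      using le[OF p(2,3)] d(2)[of j] p(3) by (auto simp: D_def)
    then have "1 / real (n - card e) \<le> 1 / real (n - D j)"
      by (intro divide_left_mono) auto
    then show "(case p of (e, j) \<Rightarrow> 1 / real (n - card e)) \<le> (case p of (e, j) \<Rightarrow> 1 / real (n - D j))"
      using p by simp
  qed
  then have "n - card e = n - D j" by simp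
  then show ?thesis using c(2)[OF e(1)] d(2)[of j] e(2) unfolding D_def by auto
qed

text \<open>The counterexample \<open>x\<close> is the constant \<open>1 / r\<close>. A cover in the decomposition of \<open>x\<close> raised to \<open>1\<close>
  at a vertex has size strictly between \<open>n / r\<close> and \<open>n / r + 1\<close>, where \<open>n\<close> is the number of
  vertices, whereas the Koenig property makes \<open>n / r\<close> an integer.\<close>

lemma ideal_if_minors_ideal:
  fixes F :: "'a set set"
  assumes Y: "finite Y" and F: "F \<subseteq> Pow Y"
    and konig: "{} \<notin> F \<Longrightarrow> konig Y F"
    and del: "\<And>j. j \<in> Y \<Longrightarrow> ideal_clutter (Y - {j}) {f \<in> F. j \<notin> f}"
    and con: "\<And>j. j \<in> Y \<Longrightarrow> ideal_clutter (Y - {j}) ((\<lambda>f. f - {j}) ` F)"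
  shows "ideal_clutter Y F"
proof (rule ccontr)
  assume bad: "\<not> ideal_clutter Y F"
  have zero: "dominated Y F x" if "fractional_cover Y F x" "j \<in> Y" "x j = 0" for x j
    using Y F that(2) con[OF that(2)] that(1,3) by (rule dominated_if_contraction)
  obtain x where x: "fractional_cover Y F x" "\<not> dominated Y F x"
    and det0: "determining Y {e \<in> F. sum x e = 1}"
    using Y F bad zero by (rule extreme_counterexample)
  have fF: "finite F" using Y F finite_subset by blast
  have pos: "0 < x j" if "j \<in> Y" for j
    using x zero[OF x(1) that] that
    unfolding fractional_cover_def by (metis order_le_less)
  have raise: "\<exists>l. cover_weights Y F l \<and> (\<forall>b. l b \<noteq> 0 \<longrightarrow> j \<in> b) \<and>
      (\<forall>v\<in>Y - {j}. load Y l v \<le> x v) \<and> load Y l j = 1" if "j \<in> Y" for j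
    by (rule raised_weights[OF Y F that del[OF that] x(1)]) blast
  \<comment> \<open>If \<open>x j\<close> were at least 1, the weights raised at \<open>j\<close>
    would already dominate \<open>x\<close>.\<close>
  have lt1: "x j < 1" if j: "j \<in> Y" for j
  proof (rule ccontr)
    assume "\<not> x j < 1"
    obtain l where "cover_weights Y F l" "\<forall>v\<in>Y - {j}. load Y l v \<le> x v" "load Y l j = 1"
      using raise[OF j] by blast
    then have "dominated Y F x" using \<open>\<not> x j < 1\<close> unfolding dominated_def
      by (metis DiffI linorder_not_less singletonD)
    then show False using x by simp
  qed
  define T where "T = {e \<in> F. sum x e = 1}"
  have TY: "T \<subseteq> Pow Y" using F unfolding T_def by blast
  obtain R where R: "R \<subseteq> T" "card R = card Y"
    and det: "determining Y R"
    by (rule determining_subfamily[OF Y TY det0[folded T_def]])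
  have RF: "R \<subseteq> F" and tight: "\<And>e. e \<in> R \<Longrightarrow> sum x e = 1" using R unfolding T_def by auto
  have RY: "R \<subseteq> Pow Y" using RF F by blast
  have fR: "finite R" using RF fF finite_subset by blast
  have fe: "finite e" if "e \<in> R" for e using RY Y that finite_subset by blast
  have deg: "card e \<le> card {f \<in> R. j \<in> f}" if e: "e \<in> R" "j \<in> Y - e" for e j
  proof -
    have jY: "j \<in> Y" "j \<notin> e" using e by auto
    obtain l where l: "cover_weights Y F l" "\<And>b. l b \<noteq> 0 \<Longrightarrow> j \<in> b"
        "\<And>v. v \<in> Y - {j} \<Longrightarrow> load Y l v \<le> x v" using raise[OF jY(1)] by blast
    show ?thesis
      by (rule counterexample_degree[OF Y F RF tight det pos lt1[OF jY(1)] l e(1) jY])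
  qed
  \<comment> \<open>If \<open>j\<close> were in all members of \<open>R\<close>, the unit vector at
    \<open>j\<close> would have the same sums over \<open>R\<close> as \<open>x\<close>, which
    forces \<open>x j = 1\<close>.\<close>
  have notall: "\<exists>e\<in>R. j \<notin> e" if j: "j \<in> Y" for j
  proof (rule ccontr)
    assume all: "\<not> ?thesis"
    have "of_bool (j = j) - x j = 0"
    proof (rule determiningD[OF det _ j, where v = "\<lambda>i. of_bool (i = j) - x i"])
      fix e assume e: "e \<in> R"
      then have "(\<Sum>i\<in>e. of_bool (i = j) :: real) = 1" using all fe[OF e] by (simp add: of_bool_def)
      then show "(\<Sum>i\<in>e. of_bool (i = j) - x i) = 0" using tight[OF e] by (simp add: sum_subtractf)
    qed
    then show False using lt1[OF j] by simp
  qed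
  have Yne: "Y \<noteq> {}"
  proof
    assume "Y = {}"
    then have "F \<subseteq> {{}}" "{} \<notin> F" using F x(1) unfolding fractional_cover_def by auto
    then have "F = {}" by auto
    then have "cover_weights Y F (\<lambda>b. of_bool (b = {}))"
      using \<open>Y = {}\<close> unfolding cover_weights_def vertex_cover_def by auto
    then show False using x(2) \<open>Y = {}\<close> unfolding dominated_def by auto
  qed
  have x_psub: "sum x f < sum x g" if "f \<subset> g" "g \<subseteq> Y" for f g
  proof -
    obtain i where "i \<in> g - f" using \<open>f \<subset> g\<close> by blast
    then show ?thesis using that Y pos
      by (intro sum_strict_mono2[of g f i]) (auto intro: finite_subset less_imp_le)
  qed
  have notY: "e \<noteq> Y" if e: "e \<in> R" for e
  proof
    assume "e = Y"
    obtain j where "j \<in> Y" using Yne by blast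
    then obtain f where f: "f \<in> R" "j \<notin> f" using notall by blast
    then have "f \<subset> Y" using RY \<open>j \<in> Y\<close> by blast
    then show False using x_psub[of f Y] tight f(1) e \<open>e = Y\<close> by auto
  qed
  have eq: "card e = card {f \<in> R. j \<in> f}" if "e \<in> R" "j \<in> Y - e" for e j
    by (rule bipartite_degrees_equal[OF Y fR RY R(2) deg notY notall that])
  have noempty: "{} \<notin> F" using x(1) unfolding fractional_cover_def by force
  then obtain Z M where Z: "vertex_cover Y F Z" and M: "M \<subseteq> F" "disjoint M" "card M = card Z"
    using konig unfolding konig_def by blast
  have fM: "finite M" using M(1) fF finite_subset by blast
  have fZ: "finite Z" using Z Y finite_subset unfolding vertex_cover_def by blast
  have M_le: "real (card M) \<le> sum x Y"
  proof -
    have "real (card M) = (\<Sum>e\<in>M. 1)" by simp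
    also have "\<dots> \<le> (\<Sum>e\<in>M. sum x e)"
      using x(1) M(1) unfolding fractional_cover_def by (intro sum_mono) auto
    also have "\<dots> = sum x (\<Union>M)"
    proof -
      have "\<forall>e\<in>M. finite e" using M(1) F Y by (meson PowD finite_subset subsetD)
      moreover have "\<forall>e\<in>M. \<forall>e'\<in>M. e \<noteq> e' \<longrightarrow> e \<inter> e' = {}"
        using M(2) by (auto simp: disjoint_def)
      ultimately show ?thesis by (rule sum.Union_disjoint[unfolded comp_def, symmetric])
    qed
    also have "\<dots> \<le> sum x Y" using M(1) F Y pos by (intro sum_mono2) (auto intro: less_imp_le)
    finally show ?thesis .
  qed
  \<comment> \<open>Members of different sizes have union \<open>Y\<close>, since a vertex outside
    both would have both sizes as its degree. Hence \<open>sum x Y \<le> 2\<close>, and the Koenig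
    property yields a cover and a matching of size exactly 2. Then such members are complementary
    and \<open>R\<close> has at most two members; \<open>card R = card Y\<close> makes both
    singletons, of equal size.\<close>
  have same: "card e = card e'" if e: "e \<in> R" "e' \<in> R" for e e'
  proof (rule ccontr)
    assume ne: "card e \<noteq> card e'"
    have un: "f \<union> g = Y" if "f \<in> R" "g \<in> R" "card f \<noteq> card g" for f g
      using eq[OF that(1)] eq[OF that(2)] that(3) RY that(1,2) by fastforce
    have incl: "sum x f + sum x g = sum x Y + sum x (f \<inter> g)"
      if "f \<in> R" "g \<in> R" "card f \<noteq> card g" for f g
      using sum.union_inter[of f g x] un[OF that] fe that by simp
    have int0: "0 \<le> sum x (f \<inter> g)" if "f \<in> R" for f g
      using pos RY that by (intro sum_nonneg) (auto intro: less_imp_le)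
    have "sum x Y \<le> 2" using incl[OF e ne] int0[OF e(1), of e'] tight e by simp
    then have "card Z \<le> 2" using M_le M(3) by linarith
    moreover have "card Z \<noteq> 0"
    proof
      assume "card Z = 0"
      then have "Z = {}" using fZ by simp
      then show False using Z RF e(1) unfolding vertex_cover_def by auto
    qed
    moreover have "card Z \<noteq> 1"
    proof
      assume "card Z = 1"
      then obtain j where "Z = {j}" by (auto simp: card_1_singleton_iff)
      then show False using Z notall[of j] RF unfolding vertex_cover_def by auto
    qed
    ultimately have "card M = 2" using M(3) by linarith
    then have ge2: "2 \<le> sum x Y" using M_le by simp
    have compl: "g = Y - f" if "f \<in> R" "g \<in> R" "card f \<noteq> card g" for f g
    proof -
      have "sum x (f \<inter> g) \<le> 0" using incl[OF that] tight that ge2 by simp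
      then have "f \<inter> g = {}" using x_psub[of "{}" "f \<inter> g"] RY that(1) by force
      then show ?thesis using un[OF that] by blast
    qed
    have "R \<subseteq> {e, e'}"
    proof
      fix f assume f: "f \<in> R"
      show "f \<in> {e, e'}"
      proof (cases "card e = card f")
        case True
        then have "card e' \<noteq> card f" using ne by simp
        then show ?thesis using compl[OF e(2) f] compl[OF e(2) e(1)] ne by simp
      next
        case False
        then show ?thesis using compl[OF e(1) f] compl[OF e ne] by simp
      qed
    qed
    then have "card R \<le> 2" using card_mono[of "{e, e'}" R] by (simp add: card_insert_if split: if_splits)
    moreover have "card Y = card e + card e'"
      using card_Int_Diff[OF Y, of e] compl[OF e ne] RY e(1) by (auto simp: Int_absorb1)
    moreover have "1 \<le> card e" "1 \<le> card e'" using tight[OF e(1)] tight[OF e(2)] fe e by (auto simp: Suc_le_eq card_gt_0_iff)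
    ultimately have "card e = 1" "card e' = 1" using R(2) by linarith+
    then show False using ne by simp
  qed
  have "R \<noteq> {}" using R(2) Yne Y by auto
  then obtain e0 where e0: "e0 \<in> R" by blast
  define r where "r = card e0"
  have r: "\<And>e. e \<in> R \<Longrightarrow> card e = r" using same e0 r_def by blast
  have r0: "0 < r" unfolding r_def using tight[OF e0] fe[OF e0] by (auto simp: card_gt_0_iff)
  have Dr: "card {f \<in> R. j \<in> f} = r" if "j \<in> Y" for j
    using notall[OF that] eq r that by (metis DiffI)
  \<comment> \<open>The constant \<open>1 / r\<close> has the same sums over \<open>R\<close> as
    \<open>x\<close>.\<close>
  have xr: "x j = 1 / r" if j: "j \<in> Y" for j
  proof -
    have "x j - 1 / r = 0"
      by (rule determiningD[OF det _ j]) (use tight r r0 in \<open>simp add: sum_subtractf\<close>)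
    then show ?thesis by simp
  qed
  have count: "(\<Sum>e\<in>R. card (b \<inter> e)) = r * card b" if "b \<subseteq> Y" for b
  proof -
    have fb: "finite b" using that Y finite_subset by blast
    have "(\<Sum>e\<in>R. card (b \<inter> e)) = (\<Sum>e\<in>R. \<Sum>j\<in>b. of_bool (j \<in> e))"
      using fb by (simp add: sum_of_bool_eq Int_def)
    also have "\<dots> = (\<Sum>j\<in>b. \<Sum>e\<in>R. of_bool (j \<in> e))" by (rule sum.swap)
    also have "\<dots> = (\<Sum>j\<in>b. r)"
      using that fR Dr by (intro sum.cong) (auto simp: sum_of_bool_eq Int_def)
    finally show ?thesis by simp
  qed
  have cov1: "1 \<le> card (b \<inter> e)" if "vertex_cover Y F b" "e \<in> R" for b e
    using that RF fe[OF that(2)] unfolding vertex_cover_def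
    by (metis One_nat_def Suc_leI card_gt_0_iff finite_Int subsetD)
  have cov: "card Y \<le> r * card b" if b: "vertex_cover Y F b" for b
  proof -
    have "card Y = (\<Sum>e\<in>R. 1)" using R(2) by simp
    also have "\<dots> \<le> (\<Sum>e\<in>R. card (b \<inter> e))" using cov1[OF b] by (intro sum_mono)
    finally show ?thesis using count b unfolding vertex_cover_def by simp
  qed
  have sxY: "sum x Y = card Y / r" using xr by simp
  \<comment> \<open>The matching gives one inequality and \<open>cov\<close> the other: the smallest
    covers have \<open>card Y / r\<close> vertices.\<close>
  have "real r * card Z \<le> card Y" using M_le M(3) r0 unfolding sxY by (simp add: field_simps)
  then have rZ: "r * card Z = card Y" using cov[OF Z] by (simp flip: of_nat_mult)
  obtain j where j: "j \<in> Y" using Yne by blast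
  obtain l where l: "cover_weights Y F l" "\<And>b. l b \<noteq> 0 \<Longrightarrow> j \<in> b"
      "\<And>v. v \<in> Y - {j} \<Longrightarrow> load Y l v \<le> x v" "load Y l j = 1" using raise[OF j] by blast
  \<comment> \<open>The average size of a cover under \<open>l\<close> is the total load, at most
    \<open>1 + (card Y - 1) / r\<close>, which is less than \<open>(card Y + r) / r\<close>.\<close>
  have "\<exists>b. l b \<noteq> 0 \<and> r * card b < card Y + r"
  proof (rule ccontr)
    assume neg: "\<not> ?thesis"
    have "(\<Sum>v\<in>Y. load Y l v) = 1 + (\<Sum>v\<in>Y - {j}. load Y l v)"
      using Y j l(4) by (simp add: sum.remove)
    also have "\<dots> \<le> 1 + (\<Sum>v\<in>Y - {j}. x v)" using l(3) by (intro add_left_mono sum_mono)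
    also have "\<dots> = 1 + (card Y - 1) / r" using xr Y j by (simp add: card_Diff_singleton)
    finally have total: "(\<Sum>v\<in>Y. load Y l v) \<le> 1 + (card Y - 1) / r" .
    have "(card Y + r) * (\<Sum>b\<in>Pow Y. l b) = (\<Sum>b\<in>Pow Y. l b * (card Y + r))"
      by (subst mult.commute) (rule sum_distrib_right)
    also have "\<dots> \<le> (\<Sum>b\<in>Pow Y. l b * (r * card (b \<inter> Y)))"
    proof (rule sum_mono)
      fix b assume "b \<in> Pow Y"
      then have "b \<inter> Y = b" by blast
      then show "l b * (card Y + r) \<le> l b * (r * card (b \<inter> Y))"
        using neg l(1) unfolding cover_weights_def
        by (cases "l b = 0") (auto intro!: mult_left_mono simp: not_less simp flip: of_nat_add of_nat_mult)
    qed
    also have "\<dots> = r * (\<Sum>v\<in>Y. load Y l v)"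
      unfolding sum_load[OF Y order_refl] sum_distrib_left by (simp add: mult_ac)
    also have "\<dots> \<le> r * (1 + (card Y - 1) / r)" using total by (rule mult_left_mono) simp
    finally have "(card Y + r) * (\<Sum>b\<in>Pow Y. l b) \<le> r * (1 + (card Y - 1) / r)" .
    then have "real (card Y + r) \<le> r + (card Y - 1)"
      using l(1) r0 unfolding cover_weights_def by (simp add: field_simps)
    moreover have "0 < card Y" using Y Yne by (simp add: card_gt_0_iff)
    ultimately show False by (simp add: of_nat_diff)
  qed
  then obtain b where b: "l b \<noteq> 0" "r * card b < card Y + r" by blast
  have vb: "vertex_cover Y F b" using l(1) b(1) unfolding cover_weights_def by blast
  \<comment> \<open>Otherwise \<open>b\<close> meets each member of \<open>R\<close> exactly once,
    so its characteristic vector agrees with \<open>x\<close> on \<open>Y\<close>; but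
    \<open>j\<close> lies in \<open>b\<close> and \<open>x j < 1\<close>.\<close>
  have "r * card b \<noteq> card Y"
  proof
    assume "r * card b = card Y"
    then have "(\<Sum>e\<in>R. 1) = (\<Sum>e\<in>R. card (b \<inter> e))"
      using count[of b] vb R(2) unfolding vertex_cover_def by simp
    from sum_mono_inv[OF this cov1[OF vb] _ fR]
    have one: "card (b \<inter> e) = 1" if "e \<in> R" for e using that by simp
    have "of_bool (j \<in> b) - x j = 0"
    proof (rule determiningD[OF det _ j, where v = "\<lambda>i. of_bool (i \<in> b) - x i"])
      fix e assume e: "e \<in> R"
      then have "(\<Sum>i\<in>e. of_bool (i \<in> b) :: real) = real (card (b \<inter> e))"
        using fe[OF e] by (simp add: sum_of_bool_eq Int_def conj_commute)
      then show "(\<Sum>i\<in>e. of_bool (i \<in> b) - x i) = 0"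
        using tight[OF e] one[OF e] by (simp add: sum_subtractf)
    qed
    then show False using l(2)[OF b(1)] lt1[OF j] by simp
  qed
  then have "r * card Z < r * card b" "r * card b < r * Suc (card Z)"
    using cov[OF vb] rZ b(2) by auto
  then have "card Z < card b" "card b < Suc (card Z)" using r0 by (simp_all del: mult_Suc_right)
  then show False by simp
qed

section \<open>Ideality from the Koenig property of all minors\<close>

text \<open>\<open>A\<close> is deleted (variables set to 0) and \<open>B\<close> is contracted
  (variables set to 1). Sets that are not minimal are kept, so that successive deletions and
  contractions compose literally.\<close>

definition set_minor :: "'a set set \<Rightarrow> 'a set \<Rightarrow> 'a set \<Rightarrow> 'a set set" where
  "set_minor E A B = (\<lambda>f. f - B) ` {f \<in> E. f \<inter> A = {}}"

text \<open>The packing property in terms of sets, without a field; absence of the empty set stands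
  for properness of the ideal.\<close>

definition packs :: "'a set \<Rightarrow> 'a set set \<Rightarrow> bool" where
  "packs X E \<longleftrightarrow> (\<forall>A B. A \<subseteq> X \<longrightarrow> B \<subseteq> X \<longrightarrow> A \<inter> B = {} \<longrightarrow> {} \<notin> set_minor E A B \<longrightarrow>
     konig (X - (A \<union> B)) (set_minor E A B))"

text \<open>Induction on the number of remaining vertices: deleting or contracting one more vertex
  in a set minor of \<open>E\<close> gives a set minor of \<open>E\<close> again.\<close>

lemma packs_imp_minor_ideal:
  assumes "finite X" "E \<subseteq> Pow X" "packs X E" "A \<subseteq> X" "B \<subseteq> X" "A \<inter> B = {}"
  shows "ideal_clutter (X - (A \<union> B)) (set_minor E A B)"
  using assms(4-6)
proof (induction "card (X - (A \<union> B))" arbitrary: A B rule: less_induct)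
  case less
  let ?Y = "X - (A \<union> B)"
  have "card (?Y - {j}) < card ?Y" if "j \<in> ?Y" for j
    using assms(1) that by (intro card_Diff1_less) auto
  moreover have "?Y - {j} = X - (insert j A \<union> B)" "?Y - {j} = X - (A \<union> insert j B)" for j by auto
  ultimately have smaller: "card (X - (insert j A \<union> B)) < card ?Y" "card (X - (A \<union> insert j B)) < card ?Y"
    if "j \<in> ?Y" for j using that by metis+
  show ?case
  proof (rule ideal_if_minors_ideal)
    show "finite ?Y" using assms(1) by simp
    show "set_minor E A B \<subseteq> Pow ?Y" using assms(2) unfolding set_minor_def by auto
    show "konig ?Y (set_minor E A B)" if "{} \<notin> set_minor E A B"
      using assms(3) less.prems that unfolding packs_def by blast
  next
    fix j assume j: "j \<in> ?Y"
    have "{f \<in> set_minor E A B. j \<notin> f} = set_minor E (insert j A) B"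
      using j unfolding set_minor_def by auto
    moreover have "?Y - {j} = X - (insert j A \<union> B)" by auto
    ultimately show "ideal_clutter (?Y - {j}) {f \<in> set_minor E A B. j \<notin> f}"
      using less.hyps[OF smaller(1)[OF j]] less.prems j by auto
  next
    fix j assume j: "j \<in> ?Y"
    have "(\<lambda>f. f - {j}) ` set_minor E A B = set_minor E A (insert j B)"
      unfolding set_minor_def image_image by (rule image_cong) auto
    moreover have "?Y - {j} = X - (A \<union> insert j B)" by auto
    ultimately show "ideal_clutter (?Y - {j}) ((\<lambda>f. f - {j}) ` set_minor E A B)"
      using less.hyps[OF smaller(2)[OF j]] less.prems j by auto
  qed
qed

lemma packs_imp_ideal:
  assumes "finite X" "E \<subseteq> Pow X" "packs X E"
  shows "ideal_clutter X E"
  using packs_imp_minor_ideal[OF assms, of "{}" "{}"] by (simp add: set_minor_def)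

section \<open>Minors of edge ideals\<close>

definition squarefree_exponent :: "'a set \<Rightarrow> 'a \<Rightarrow>\<^sub>0 nat" where
  "squarefree_exponent e = (\<Sum>x\<in>e. Poly_Mapping.single x 1)"

lemma lookup_sum_single:
  "finite S \<Longrightarrow> Poly_Mapping.lookup (\<Sum>x\<in>S. Poly_Mapping.single x (g x)) y = (if y \<in> S then g y else 0)"
  by (induction S rule: finite_induct) (auto simp: lookup_add lookup_single when_def)

lemma lookup_squarefree_exponent:
  "finite e \<Longrightarrow> Poly_Mapping.lookup (squarefree_exponent e) x = of_bool (x \<in> e)"
  unfolding squarefree_exponent_def by (simp add: lookup_sum_single)

lemma keys_squarefree_exponent: "finite e \<Longrightarrow> Poly_Mapping.keys (squarefree_exponent e) = e"
  by (auto simp: in_keys_iff lookup_squarefree_exponent)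

lemma squarefree_exponent_dvd:
  assumes "finite e" "e \<subseteq> Poly_Mapping.keys m"
  shows "Poly_Mapping.lookup (squarefree_exponent e) x \<le> Poly_Mapping.lookup m x"
  using assms by (auto simp: lookup_squarefree_exponent in_keys_iff of_bool_def Suc_le_eq)

lemma prod_single_one:
  "(\<Prod>x\<in>e. Poly_Mapping.single (f x) (1 :: 'k::comm_semiring_1)) = Poly_Mapping.single (\<Sum>x\<in>e. f x :: 'b::comm_monoid_add) 1"
  by (induction e rule: infinite_finite_induct) (auto simp: mult_single)

lemma prod_var: "(\<Prod>x\<in>e. var x) = Poly_Mapping.single (squarefree_exponent e) 1"
  unfolding var_def squarefree_exponent_def by (rule prod_single_one)

text \<open>A polynomial lies in a monomial ideal iff each of its monomials is divisible by a
  generator, and divisibility by a squarefree monomial depends only on the support.\<close>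

lemma edge_ideal_eq:
  assumes X: "finite X" and E: "E \<subseteq> Pow X"
  shows "(edge_ideal X E :: ('a, 'k::field) mpolynomial set) =
    {p. \<forall>m\<in>Poly_Mapping.keys p. Poly_Mapping.keys m \<subseteq> X \<and> (\<exists>f\<in>E. f \<subseteq> Poly_Mapping.keys m)}"
    (is "_ = ?J")
proof -
  let ?R = "polynomial_ring X :: ('a, 'k) mpolynomial ring"
  let ?S = "(\<lambda>e. \<Prod>x\<in>e. var x) ` E :: ('a, 'k) mpolynomial set"
  interpret R: cring ?R by (rule cring_polynomial_ring)
  have R: "carrier ?R = {p. \<forall>m\<in>Poly_Mapping.keys p. Poly_Mapping.keys m \<subseteq> X}"
    "monoid.mult ?R = (*)" "ring.zero ?R = 0" "ring.add ?R = (+)"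
    by (simp_all add: polynomial_ring_def)
  have fin: "finite f" if "f \<in> E" for f using that E X finite_subset by blast
  have "ideal ?J ?R"
  proof (rule idealI)
    show "ring ?R" by (rule R.ring_axioms)
    show "subgroup ?J (add_monoid ?R)"
    proof
      show "?J \<subseteq> carrier (add_monoid ?R)" using R(1) by auto
      show "x \<otimes>\<^bsub>add_monoid ?R\<^esub> y \<in> ?J" if "x \<in> ?J" "y \<in> ?J" for x y
      proof -
        have "x + y \<in> ?J" using that Poly_Mapping.keys_add[of x y] by blast
        then show ?thesis using R(4) by simp
      qed
      show "\<one>\<^bsub>add_monoid ?R\<^esub> \<in> ?J" using R(3) by simp
      show "inv\<^bsub>add_monoid ?R\<^esub> x \<in> ?J" if x: "x \<in> ?J" for x
      proof -
        have "\<ominus>\<^bsub>?R\<^esub> x = - x"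
          using x R by (intro R.minus_equality) auto
        then show ?thesis using x unfolding a_inv_def by simp
      qed
    qed
  next
    fix a x assume a: "a \<in> ?J" and x: "x \<in> carrier ?R"
    have *: "Poly_Mapping.keys m \<subseteq> X \<and> (\<exists>f\<in>E. f \<subseteq> Poly_Mapping.keys m)"
      if m: "m \<in> Poly_Mapping.keys (x * a)" for m
    proof -
      obtain b c where m: "m = b + c" and b: "b \<in> Poly_Mapping.keys x" and c: "c \<in> Poly_Mapping.keys a"
        using subsetD[OF Poly_Mapping.keys_mult m] by blast
      have k: "Poly_Mapping.keys m = Poly_Mapping.keys b \<union> Poly_Mapping.keys c"
        unfolding m by (auto simp: in_keys_iff lookup_add)
      have "Poly_Mapping.keys b \<subseteq> X" using x b R(1) by simp
      moreover have "Poly_Mapping.keys c \<subseteq> X" using a c by simp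
      moreover obtain f where "f \<in> E" "f \<subseteq> Poly_Mapping.keys c" using a c by auto
      ultimately show ?thesis unfolding k by blast
    qed
    show "x \<otimes>\<^bsub>?R\<^esub> a \<in> ?J" using * R(2) by simp
    show "a \<otimes>\<^bsub>?R\<^esub> x \<in> ?J" using * R(2) by (simp add: mult.commute)
  qed
  moreover have "?S \<subseteq> ?J"
  proof (rule image_subsetI)
    fix e assume "e \<in> E"
    moreover from this have "e \<subseteq> X" using E by blast
    ultimately show "(\<Prod>x\<in>e. var x) \<in> ?J" by (auto simp: prod_var keys_squarefree_exponent fin)
  qed
  ultimately have sub: "edge_ideal X E \<subseteq> ?J" unfolding edge_ideal_def genideal_def by blast
  \<comment> \<open>Any such \<open>p\<close> is the sum of its terms, and each term is a multiple
    of a generator.\<close>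
  have "?J \<subseteq> I" if I: "ideal I ?R" and S: "?S \<subseteq> I" for I
  proof
    fix p assume p: "p \<in> ?J"
    have zero: "0 \<in> I" using additive_subgroup.zero_closed[OF ideal.axioms(1)[OF I]] R(3) by simp
    have add: "a + b \<in> I" if "a \<in> I" "b \<in> I" for a b
      using additive_subgroup.a_closed[OF ideal.axioms(1)[OF I] that] R(4) by simp
    have mono: "Poly_Mapping.single m (Poly_Mapping.lookup p m) \<in> I" if m: "m \<in> Poly_Mapping.keys p" for m
    proof -
      obtain f where f: "f \<in> E" "f \<subseteq> Poly_Mapping.keys m" and mX: "Poly_Mapping.keys m \<subseteq> X"
        using p m by blast
      define n where "n = m - squarefree_exponent f"
      have mn: "n + squarefree_exponent f = m"
        unfolding n_def using squarefree_exponent_dvd[OF fin[OF f(1)] f(2)]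
        by (intro poly_mapping_eqI) (simp add: lookup_add lookup_minus)
      have "Poly_Mapping.keys n \<subseteq> X" using mX unfolding mn[symmetric] by (auto simp: in_keys_iff lookup_add)
      then have "Poly_Mapping.single n (Poly_Mapping.lookup p m) \<in> carrier ?R"
        unfolding R(1) by auto
      moreover have "Poly_Mapping.single (squarefree_exponent f) 1 \<in> I"
        using S f(1) unfolding prod_var by blast
      ultimately have "Poly_Mapping.single n (Poly_Mapping.lookup p m) * Poly_Mapping.single (squarefree_exponent f) 1 \<in> I"
        using ideal.I_l_closed[OF I] R(2) by fastforce
      then show ?thesis by (simp add: mult_single mn)
    qed
    have "(\<Sum>m\<in>M. Poly_Mapping.single m (Poly_Mapping.lookup p m)) \<in> I"
      if "M \<subseteq> Poly_Mapping.keys p" "finite M" for M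
      using that(2,1) by (induction M rule: finite_induct) (auto intro: zero add mono)
    from this[OF order_refl] have "(\<Sum>m\<in>Poly_Mapping.keys p. Poly_Mapping.single m (Poly_Mapping.lookup p m)) \<in> I"
      by simp
    also have "(\<Sum>m\<in>Poly_Mapping.keys p. Poly_Mapping.single m (Poly_Mapping.lookup p m)) = p"
      by (rule poly_mapping_eqI) (simp add: lookup_sum_single in_keys_iff)
    finally show "p \<in> I" .
  qed
  then have "?J \<subseteq> edge_ideal X E" unfolding edge_ideal_def genideal_def by blast
  with sub show ?thesis by blast
qed

section \<open>Setting variables to 0 and to 1\<close>

lemma specialize_monomial:
  fixes S T :: "'a set"
  defines "q \<equiv> \<lambda>m x. ((if x \<in> S then 0 else if x \<in> T then 1 else var x) :: ('a, 'k::field) mpolynomial)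
    ^ Poly_Mapping.lookup m x"
  shows "(\<Prod>x\<in>Poly_Mapping.keys m. q m x) = (if Poly_Mapping.keys m \<inter> S = {}
     then Poly_Mapping.single (\<Sum>x\<in>Poly_Mapping.keys m - T. Poly_Mapping.single x (Poly_Mapping.lookup m x)) 1 else 0)"
proof (cases "Poly_Mapping.keys m \<inter> S = {}")
  case True
  have vp: "(var x :: ('a, 'k) mpolynomial) ^ k = Poly_Mapping.single (Poly_Mapping.single x k) 1" for x k
    unfolding var_def by (induction k) (auto simp: mult_single simp flip: single_add)
  have "(\<Prod>x\<in>Poly_Mapping.keys m. q m x) = (\<Prod>x\<in>Poly_Mapping.keys m - T. q m x)"
    using True by (intro prod.mono_neutral_right) (auto simp: q_def)
  also have "\<dots> = (\<Prod>x\<in>Poly_Mapping.keys m - T. Poly_Mapping.single (Poly_Mapping.single x (Poly_Mapping.lookup m x)) 1)"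
    using True by (intro prod.cong) (auto simp: q_def vp)
  finally show ?thesis using True by (simp add: prod_single_one)
next
  case False
  then obtain x where x: "x \<in> Poly_Mapping.keys m" "x \<in> S" by blast
  then have "q m x = 0" by (simp add: q_def in_keys_iff zero_power)
  then show ?thesis using False x(1) by (auto intro!: prod_zero bexI[of _ x])
qed


definition restrict_exponent :: "('a \<Rightarrow>\<^sub>0 nat) \<Rightarrow> 'a set \<Rightarrow> ('a \<Rightarrow>\<^sub>0 nat)" where
  "restrict_exponent m B = (\<Sum>x\<in>Poly_Mapping.keys m \<inter> B. Poly_Mapping.single x (Poly_Mapping.lookup m x))"

lemma lookup_restrict_exponent:
  "Poly_Mapping.lookup (restrict_exponent m B) y = (if y \<in> B then Poly_Mapping.lookup m y else 0)"
  unfolding restrict_exponent_def by (simp add: lookup_sum_single in_keys_iff)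

lemma keys_restrict_exponent: "Poly_Mapping.keys (restrict_exponent m B) = Poly_Mapping.keys m \<inter> B"
  by (auto simp: in_keys_iff lookup_restrict_exponent split: if_splits)

lemma specialize_eq:
  "specialize S T (p :: ('a, 'k::field) mpolynomial) =
    (\<Sum>m\<in>Poly_Mapping.keys p. if Poly_Mapping.keys m \<inter> S = {}
      then Poly_Mapping.single (restrict_exponent m (- T)) (Poly_Mapping.lookup p m) else 0)"
  unfolding specialize_def restrict_exponent_def Diff_eq[symmetric]
  by (intro sum.cong refl, subst specialize_monomial) (auto simp: mult_single)

text \<open>Specialization sends each term to 0 or to a term, so a monomial in the image comes from
  a term of a member of the ideal. Conversely, a monomial whose support contains
  \<open>f - T\<close> is lifted by multiplying it with the variables in
  \<open>f \<inter> T\<close>.\<close>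

lemma monomial_in_specialized_edge_ideal_iff:
  fixes X :: "'a set"
  assumes X: "finite X" and E: "E \<subseteq> Pow X" and ST: "S \<subseteq> X" "T \<subseteq> X" "S \<inter> T = {}"
  shows "(Poly_Mapping.single n 1 :: ('a, 'k::field) mpolynomial) \<in> specialize S T ` edge_ideal X E \<longleftrightarrow>
    Poly_Mapping.keys n \<subseteq> X - (S \<union> T) \<and> (\<exists>g\<in>set_minor E S T. g \<subseteq> Poly_Mapping.keys n)"
proof
  assume "(Poly_Mapping.single n 1 :: ('a, 'k) mpolynomial) \<in> specialize S T ` edge_ideal X E"
  then obtain p :: "('a, 'k) mpolynomial" where p: "p \<in> edge_ideal X E"
    and eq: "Poly_Mapping.single n 1 = specialize S T p" by blast
  let ?q = "\<lambda>m. if Poly_Mapping.keys m \<inter> S = {}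
      then Poly_Mapping.single (restrict_exponent m (- T)) (Poly_Mapping.lookup p m) else 0"
  have "Poly_Mapping.lookup (\<Sum>m\<in>Poly_Mapping.keys p. ?q m) n \<noteq> 0"
    unfolding specialize_eq[symmetric] eq[symmetric] by simp
  then have "(\<Sum>m\<in>Poly_Mapping.keys p. Poly_Mapping.lookup (?q m) n) \<noteq> 0"
    by (simp add: lookup_sum)
  then obtain m where m: "m \<in> Poly_Mapping.keys p" "Poly_Mapping.lookup (?q m) n \<noteq> 0"
    by (rule sum.not_neutral_contains_not_neutral)
  then have mS: "Poly_Mapping.keys m \<inter> S = {}" and n: "n = restrict_exponent m (- T)"
    by (auto simp: lookup_single when_def split: if_splits)
  obtain f where f: "f \<in> E" "f \<subseteq> Poly_Mapping.keys m" and mX: "Poly_Mapping.keys m \<subseteq> X"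
    using p m(1) unfolding edge_ideal_eq[OF X E] by blast
  have kn: "Poly_Mapping.keys n = Poly_Mapping.keys m - T"
    unfolding n keys_restrict_exponent by blast
  have "f - T \<in> set_minor E S T" using f mS unfolding set_minor_def by blast
  moreover have "f - T \<subseteq> Poly_Mapping.keys n" using f(2) kn by blast
  moreover have "Poly_Mapping.keys n \<subseteq> X - (S \<union> T)" using mS mX kn by blast
  ultimately show "Poly_Mapping.keys n \<subseteq> X - (S \<union> T) \<and> (\<exists>g\<in>set_minor E S T. g \<subseteq> Poly_Mapping.keys n)"
    by blast
next
  assume n: "Poly_Mapping.keys n \<subseteq> X - (S \<union> T) \<and> (\<exists>g\<in>set_minor E S T. g \<subseteq> Poly_Mapping.keys n)"
  then obtain f where f: "f \<in> E" "f \<inter> S = {}" "f - T \<subseteq> Poly_Mapping.keys n"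
    unfolding set_minor_def by blast
  have ff: "finite f" using f(1) E X finite_subset by blast
  define m where "m = n + squarefree_exponent (f \<inter> T)"
  have km: "Poly_Mapping.keys m = Poly_Mapping.keys n \<union> (f \<inter> T)"
    unfolding m_def using ff by (auto simp: in_keys_iff lookup_add lookup_squarefree_exponent)
  have "(Poly_Mapping.single m 1 :: ('a, 'k) mpolynomial) \<in> edge_ideal X E"
    unfolding edge_ideal_eq[OF X E] using f n E ST km by auto
  moreover have "restrict_exponent m (- T) = n"
  proof (rule poly_mapping_eqI)
    fix x
    have "x \<in> T \<Longrightarrow> Poly_Mapping.lookup n x = 0" using n by (metis DiffE UnI2 in_keys_iff subsetD)
    then show "Poly_Mapping.lookup (restrict_exponent m (- T)) x = Poly_Mapping.lookup n x"
      unfolding lookup_restrict_exponent m_def using ff by (simp add: lookup_add lookup_squarefree_exponent)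
  qed
  moreover have "Poly_Mapping.keys m \<inter> S = {}" using km n f(2) by blast
  ultimately show "(Poly_Mapping.single n 1 :: ('a, 'k) mpolynomial) \<in> specialize S T ` edge_ideal X E"
    by (intro image_eqI[of _ _ "Poly_Mapping.single m 1"]) (auto simp: specialize_eq)
qed

text \<open>A monomial in the remaining variables lies in the specialized ideal iff its support
  contains a member of \<open>G\<close>, so the minimal ones are the squarefree monomials of the
  minimal members of \<open>G\<close>.\<close>

lemma keys_minimal_monomials:
  fixes X :: "'a set"
  assumes X: "finite X" and E: "E \<subseteq> Pow X" and ST: "S \<subseteq> X" "T \<subseteq> X" "S \<inter> T = {}"
  defines "G \<equiv> set_minor E S T"
  shows "Poly_Mapping.keys ` minimal_monomials (specialize S T ` (edge_ideal X E :: ('a, 'k::field) mpolynomial set))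
    = {g \<in> G. \<forall>h\<in>G. h \<subseteq> g \<longrightarrow> h = g}"
proof -
  let ?Y = "X - (S \<union> T)"
  let ?I = "specialize S T ` (edge_ideal X E :: ('a, 'k) mpolynomial set)"
  have G: "g \<subseteq> ?Y" "finite g" if "g \<in> G" for g
  proof -
    show "g \<subseteq> ?Y" using that E unfolding G_def set_minor_def by auto
    then show "finite g" using X finite_subset by blast
  qed
  note I_iff = monomial_in_specialized_edge_ideal_iff[OF X E ST, where 'k = 'k, folded G_def]
  have sq: "Poly_Mapping.single (squarefree_exponent g) 1 \<in> ?I" if "g \<in> G" for g
    unfolding I_iff keys_squarefree_exponent[OF G(2)[OF that]] using G[OF that] that by blast
  show ?thesis
  proof (intro equalityI subsetI)
    fix k assume "k \<in> Poly_Mapping.keys ` minimal_monomials ?I"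
    then obtain m where k: "k = Poly_Mapping.keys m" and mI: "Poly_Mapping.single m 1 \<in> ?I"
      and mn: "\<And>m'. Poly_Mapping.single m' 1 \<in> ?I \<Longrightarrow>
          (\<forall>x. Poly_Mapping.lookup m' x \<le> Poly_Mapping.lookup m x) \<Longrightarrow> m' = m"
      unfolding minimal_monomials_def by blast
    have sub: "h = k" if h: "h \<in> G" "h \<subseteq> k" for h
    proof -
      have "squarefree_exponent h = m"
        using mn[OF sq[OF h(1)]] squarefree_exponent_dvd[OF G(2)[OF h(1)]] h(2) k by blast
      then show ?thesis using keys_squarefree_exponent[OF G(2)[OF h(1)]] k by simp
    qed
    obtain g where "g \<in> G" "g \<subseteq> k" using mI unfolding I_iff k by blast
    then have "k \<in> G" using sub by blast
    then show "k \<in> {g \<in> G. \<forall>h\<in>G. h \<subseteq> g \<longrightarrow> h = g}" using sub by blast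
  next
    fix g assume "g \<in> {g \<in> G. \<forall>h\<in>G. h \<subseteq> g \<longrightarrow> h = g}"
    then have g: "g \<in> G" and mn: "\<And>h. h \<in> G \<Longrightarrow> h \<subseteq> g \<Longrightarrow> h = g" by auto
    have "m = squarefree_exponent g"
      if m: "Poly_Mapping.single m 1 \<in> ?I"
        "\<forall>x. Poly_Mapping.lookup m x \<le> Poly_Mapping.lookup (squarefree_exponent g) x" for m
    proof -
      have le: "Poly_Mapping.lookup m x \<le> of_bool (x \<in> g)" for x
        using m(2) lookup_squarefree_exponent[OF G(2)[OF g]] by metis
      have mg: "Poly_Mapping.keys m \<subseteq> g"
        using le by (auto simp: in_keys_iff) (metis le_zero_eq of_bool_eq(1) not_gr_zero)
      obtain h where h: "h \<in> G" "h \<subseteq> Poly_Mapping.keys m" using m(1) unfolding I_iff by blast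
      then have "Poly_Mapping.keys m = g" using mn[OF h(1)] mg by blast
      then have "Poly_Mapping.lookup m x = of_bool (x \<in> g)" for x
        using le[of x] by (cases "x \<in> g") (auto simp: in_keys_iff)
      then show ?thesis by (intro poly_mapping_eqI) (simp add: lookup_squarefree_exponent[OF G(2)[OF g]])
    qed
    then have "squarefree_exponent g \<in> minimal_monomials ?I"
      using sq[OF g] unfolding minimal_monomials_def by blast
    then show "g \<in> Poly_Mapping.keys ` minimal_monomials ?I"
      using keys_squarefree_exponent[OF G(2)[OF g]] by force
  qed
qed

text \<open>Without empty edges \<open>Y\<close> is a cover, and the empty family is a matching; so
  \<open>Min\<close> and \<open>Max\<close> range over nonempty finite sets and are
  attained.\<close>

lemma Konig_property_imp_konig:
  assumes Y: "finite Y" and F: "F \<subseteq> Pow Y" "{} \<notin> F" and K: "Konig_property Y F"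
  shows "konig Y F"
proof -
  let ?C = "{card C | C. vertex_cover Y F C}" and ?M = "{card M | M. M \<subseteq> F \<and> disjoint M}"
  have fF: "finite F" using Y F finite_subset by blast
  have "?C \<subseteq> card ` Pow Y" unfolding vertex_cover_def by auto
  then have "finite ?C" by (rule finite_subset) (simp add: Y)
  moreover have "vertex_cover Y F Y" using F unfolding vertex_cover_def by (auto simp: Int_absorb1 Pow_def)
  then have "?C \<noteq> {}" by blast
  ultimately have "covering_number Y F \<in> ?C" unfolding covering_number_def by (rule Min_in)
  then obtain Z where Z: "vertex_cover Y F Z" "covering_number Y F = card Z" by blast
  have "?M \<subseteq> card ` Pow F" by auto
  then have "finite ?M" by (rule finite_subset) (simp add: fF)
  moreover have "disjoint ({} :: 'a set set)" by (simp add: disjoint_def)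
  then have "?M \<noteq> {}" by blast
  ultimately have "matching_number F \<in> ?M" unfolding matching_number_def by (rule Max_in)
  then obtain M where "M \<subseteq> F" "disjoint M" "matching_number F = card M" by blast
  then show ?thesis using Z K unfolding konig_def Konig_property_def by metis
qed

text \<open>The minor of the ideal has the minimal members of the set minor as its edges. Every
  member contains a minimal one, so a cover of the minimal members covers all, and a matching of
  minimal members is one in the set minor.\<close>

lemma packing_property_imp_packs:
  fixes X :: "'a set"
  assumes X: "finite X" and E: "E \<subseteq> Pow X" and pack: "packing_property TYPE('k::field) X E"
  shows "packs X E"
  unfolding packs_def
proof (intro allI impI)
  fix S T assume ST: "S \<subseteq> X" "T \<subseteq> X" "S \<inter> T = {}" and ne: "{} \<notin> set_minor E S T"
  let ?Y = "X - (S \<union> T)"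
  let ?I = "specialize S T ` (edge_ideal X E :: ('a, 'k) mpolynomial set)"
  let ?F = "{g \<in> set_minor E S T. \<forall>h\<in>set_minor E S T. h \<subseteq> g \<longrightarrow> h = g}"
  \<comment> \<open>The constant 1 is in the image only if the empty set is in the set
    minor.\<close>
  have "?I \<noteq> carrier (polynomial_ring ?Y)"
  proof
    assume "?I = carrier (polynomial_ring ?Y)"
    moreover have "Poly_Mapping.single 0 1 \<in> carrier (polynomial_ring ?Y :: ('a, 'k) mpolynomial ring)"
      by (auto simp: polynomial_ring_def)
    ultimately have "(Poly_Mapping.single 0 1 :: ('a, 'k) mpolynomial) \<in> ?I" by simp
    then show False
      unfolding monomial_in_specialized_edge_ideal_iff[OF X E ST] using ne by auto
  qed
  then have "minor TYPE('k) X E ?Y ?F"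
    unfolding minor_def keys_minimal_monomials[OF X E ST, where 'k = 'k, symmetric]
    by (intro exI[of _ S] exI[of _ T] exI[of _ ?I] conjI ST refl)
  then have K: "Konig_property ?Y ?F" using pack unfolding packing_property_def by blast
  have GY: "set_minor E S T \<subseteq> Pow ?Y" using E unfolding set_minor_def by auto
  have "konig ?Y ?F"
    by (rule Konig_property_imp_konig[OF _ _ _ K]) (use X GY ne in auto)
  then obtain Z M where Z: "vertex_cover ?Y ?F Z" and M: "M \<subseteq> ?F" "disjoint M" "card M = card Z"
    unfolding konig_def by blast
  have "vertex_cover ?Y (set_minor E S T) Z"
    unfolding vertex_cover_def
  proof (intro conjI ballI)
    show "Z \<subseteq> ?Y" using Z unfolding vertex_cover_def by blast
    fix e assume e: "e \<in> set_minor E S T"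
    have "finite (set_minor E S T)" using GY X finite_subset by fastforce
    then obtain g where g: "g \<in> set_minor E S T" "g \<subseteq> e"
        "\<forall>h\<in>set_minor E S T. h \<subseteq> g \<longrightarrow> g = h"
      using finite_has_minimal2[OF _ e] by blast
    then have "Z \<inter> g \<noteq> {}" using Z unfolding vertex_cover_def by blast
    then show "Z \<inter> e \<noteq> {}" using g(2) by blast
  qed
  then show "konig ?Y (set_minor E S T)" using M unfolding konig_def by blast
qed

section \<open>Antipodal vertices and unit vectors\<close>

text \<open>The load at \<open>v\<close> is positive, so some cover of positive weight contains
  \<open>v\<close>; it has one further vertex \<open>y\<close>. All edges are tight for the constant
  \<open>1 / d\<close> and are hence met exactly once by \<open>{v, y}\<close>.\<close>

lemma antipodal_vertex:
  fixes X :: "'a set"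
  assumes X: "finite X" and E: "E \<subseteq> Pow X" and packs: "packs X E"
    and unif: "uniform d E" and d: "0 < d" and cardX: "card X = 2 * d"
    and cov: "\<And>b. vertex_cover X E b \<Longrightarrow> 2 \<le> card b" and v: "v \<in> X"
  shows "\<exists>y\<in>X. \<forall>e\<in>E. v \<in> e \<longleftrightarrow> y \<notin> e"
proof -
  define x :: "'a \<Rightarrow> real" where "x = (\<lambda>_. 1 / d)"
  have one: "sum x e = 1" if "e \<in> E" for e
    using unif that d unfolding uniform_def x_def by simp
  moreover have "0 \<le> x u" for u by (simp add: x_def)
  ultimately have "fractional_cover X E x" unfolding fractional_cover_def by simp
  then obtain l where l: "cover_weights X E l" and le: "\<And>u. u \<in> X \<Longrightarrow> load X l u \<le> x u"
    using packs_imp_ideal[OF X E packs] unfolding ideal_clutter_def dominated_def by blast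
  have ge: "l b * 2 \<le> l b * real (card (b \<inter> X))" if "b \<in> Pow X" for b
  proof (cases "l b = 0")
    case False
    then have "2 \<le> card b" using l cov unfolding cover_weights_def by blast
    moreover have "b \<inter> X = b" using that by blast
    ultimately show ?thesis using l unfolding cover_weights_def by (intro mult_left_mono) auto
  qed simp
  have "(\<Sum>b\<in>Pow X. l b * 2) = 2"
    using l unfolding cover_weights_def by (simp flip: sum_distrib_right)
  moreover have "(\<Sum>b\<in>Pow X. l b * 2) \<le> (\<Sum>b\<in>Pow X. l b * real (card (b \<inter> X)))"
    using ge by (rule sum_mono)
  moreover have "(\<Sum>b\<in>Pow X. l b * real (card (b \<inter> X))) = (\<Sum>u\<in>X. load X l u)"
    by (rule sum_load[OF X order_refl, symmetric])
  moreover have "(\<Sum>u\<in>X. load X l u) \<le> sum x X" using le by (rule sum_mono)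
  moreover have "sum x X = 2" using d by (simp add: x_def cardX)
  \<comment> \<open>The chain of inequalities starts and ends at 2, so equality holds
    throughout.\<close>
  ultimately have eq1: "(\<Sum>b\<in>Pow X. l b * 2) = (\<Sum>b\<in>Pow X. l b * real (card (b \<inter> X)))"
    and eq2: "(\<Sum>u\<in>X. load X l u) = sum x X" by linarith+
  have "load X l v = x v" by (rule sum_mono_inv[OF eq2 le v X])
  then have "load X l v \<noteq> 0" using d by (simp add: x_def)
  then obtain b where "b \<in> Pow X" "l b * of_bool (v \<in> b) \<noteq> 0"
    unfolding load_def by (rule sum.not_neutral_contains_not_neutral)
  then have b: "b \<in> Pow X" "l b \<noteq> 0" "v \<in> b" by auto
  have "finite (Pow X)" using X by simp
  from sum_mono_inv[OF eq1 ge b(1) this]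
  have "card b = 2" using b(1,2) by (auto simp: Int_absorb2)
  then have "card (b - {v}) = 1" using b(3) by (simp add: card_Diff_singleton)
  then obtain y where "b - {v} = {y}" by (auto simp: card_1_singleton_iff)
  then have y: "b = {v, y}" "v \<noteq> y" using b(3) by auto
  have "v \<in> e \<longleftrightarrow> y \<notin> e" if e: "e \<in> E" for e
  proof -
    have eX: "e \<subseteq> X" using e E by blast
    have "card (b \<inter> e) = 1"
      by (rule tight_edge_load(1)[OF X eX e l le[OF subsetD[OF eX]] one[OF e] b(2)])
    then show ?thesis using y by (cases "v \<in> e"; cases "y \<in> e") auto
  qed
  then show ?thesis using b(1) y by blast
qed

text \<open>Choosing \<open>i\<close> in the fewest edges excludes covers of size 1 in the minor: a
  single covering vertex would be the antipode of some \<open>k\<close>, and then the edges through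
  \<open>k\<close> would form a proper subset of those through \<open>i\<close>.\<close>

lemma isolating_combination:
  fixes X :: "'a set"
  assumes X: "finite X" and E: "E \<subseteq> Pow X" and packs: "packs X E"
    and e12: "e1 \<in> E" "e2 \<in> E" "e1 \<inter> e2 = {}"
    and anti: "\<And>v. v \<in> X \<Longrightarrow> \<exists>y\<in>X. \<forall>e\<in>E. v \<in> e \<longleftrightarrow> y \<notin> e"
    and I: "I \<subseteq> e1" "I \<noteq> {}"
    and dist: "\<And>i j. i \<in> I \<Longrightarrow> j \<in> I \<Longrightarrow> i \<noteq> j \<Longrightarrow> \<exists>e\<in>E. (i \<in> e) \<noteq> (j \<in> e)"
  shows "\<exists>i\<in>I. \<exists>c :: 'a set \<Rightarrow> int. \<forall>j\<in>I. (\<Sum>e\<in>E. c e * of_bool (j \<in> e)) = of_bool (j = i)"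
proof -
  have fE: "finite E" using E X finite_subset by blast
  have IX: "I \<subseteq> X" using I e12 E by blast
  have fI: "finite I" using IX X finite_subset by blast
  define D where "D i = {e \<in> E. i \<in> e}" for i
  have "\<exists>i\<in>I. \<forall>j\<in>I. card (D i) \<le> card (D j)"
    using ex_min_if_finite[of "(\<lambda>i. card (D i)) ` I"] fI I(2) by (auto simp: not_less)
  then obtain i where i: "i \<in> I" and mn: "\<And>j. j \<in> I \<Longrightarrow> card (D i) \<le> card (D j)" by blast
  have single: "(\<Sum>e\<in>E. of_bool (e = f) * of_bool (j \<in> e)) = (of_bool (j \<in> f) :: int)" if "f \<in> E" for f j
  proof -
    have "(\<Sum>e\<in>E. of_bool (e = f) * of_bool (j \<in> e)) = (\<Sum>e\<in>E. if e = f then of_bool (j \<in> f) else (0 :: int))"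
      by (rule sum.cong) auto
    then show ?thesis using fE that by simp
  qed
  show ?thesis
  proof (cases "I = {i}")
    \<comment> \<open>A singleton is treated apart, since the minor below needs a vertex of
      \<open>I\<close> other than \<open>i\<close>.\<close>
    case True
    then have "\<forall>j\<in>I. (\<Sum>e\<in>E. of_bool (e = e1) * of_bool (j \<in> e)) = (of_bool (j = i) :: int)"
      using single[OF e12(1)] I by auto
    then show ?thesis using i by (intro bexI[of _ i] exI[of _ "\<lambda>e. of_bool (e = e1)"]) auto
  next
    case False
    obtain p where p: "\<And>v. v \<in> X \<Longrightarrow> p v \<in> X" "\<And>v e. v \<in> X \<Longrightarrow> e \<in> E \<Longrightarrow> v \<in> e \<longleftrightarrow> p v \<notin> e"
      using anti by metis
    have pI: "p k \<in> X" "e \<in> E \<Longrightarrow> k \<in> e \<longleftrightarrow> p k \<notin> e" if "k \<in> I" for k e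
      using p that IX by auto
    have p_e1: "p k \<notin> e1" if "k \<in> I" for k using pI(2)[OF that e12(1)] that I by blast
    have p_inj: "p k \<noteq> p i" if k: "k \<in> I" "k \<noteq> i" for k
      using dist[OF k(1) i k(2)] pI(2)[OF k(1)] pI(2)[OF i] by auto
    \<comment> \<open>After deleting \<open>i\<close> and contracting \<open>B\<close>, the
      remaining vertices are those of \<open>I - {i}\<close> and their antipodes; the antipode of
      \<open>i\<close> is contracted too.\<close>
    define B where "B = insert (p i) (X - (I \<union> p ` I))"
    have kB: "k \<notin> B" if "k \<in> I" for k
      using that I p_e1[OF i] unfolding B_def by auto
    have pkB: "p k \<notin> B" if "k \<in> I" "k \<noteq> i" for k
      using that p_inj unfolding B_def by auto
    have BX: "B \<subseteq> X" using pI(1)[OF i] unfolding B_def by auto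
    have iB: "{i} \<inter> B = {}" using kB[OF i] by simp
    \<comment> \<open>For \<open>k\<close> other than \<open>i\<close> every edge contains
      \<open>k\<close> or \<open>p k\<close>, and neither of them is contracted.\<close>
    have ne: "{} \<notin> set_minor E {i} B"
    proof
      assume "{} \<in> set_minor E {i} B"
      then obtain f where f: "f \<in> E" "f \<subseteq> B" unfolding set_minor_def by auto
      obtain k where k: "k \<in> I" "k \<noteq> i" using False i by blast
      show False using pI(2)[OF k(1) f(1)] kB[OF k(1)] pkB[OF k] f(2) by blast
    qed
    then obtain Z M where Z: "vertex_cover (X - ({i} \<union> B)) (set_minor E {i} B) Z"
      and M: "M \<subseteq> set_minor E {i} B" "disjoint M" "card M = card Z"
      using packs BX iB i IX unfolding packs_def konig_def by (metis empty_subsetI insert_subset subsetD)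
    have hit: "Z \<inter> f \<noteq> {}" if "f \<in> E" "i \<notin> f" for f
    proof -
      have "f - B \<in> set_minor E {i} B" using that unfolding set_minor_def by auto
      then show ?thesis using Z unfolding vertex_cover_def by blast
    qed
    have ie2: "i \<notin> e2" using i I e12 by blast
    have "card Z \<noteq> 0"
    proof
      assume "card Z = 0"
      moreover have "finite Z" using Z X finite_subset unfolding vertex_cover_def by blast
      ultimately show False using hit[OF e12(2) ie2] by simp
    qed
    moreover have "card Z \<noteq> 1"
    proof
      assume "card Z = 1"
      then obtain z where z: "Z = {z}" by (auto simp: card_1_singleton_iff)
      then have "z \<in> X" "z \<noteq> i" "z \<notin> B" using Z unfolding vertex_cover_def by auto
      \<comment> \<open>The edge \<open>e2\<close> contains \<open>z\<close> but is disjoint from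
        \<open>I\<close>.\<close>
      moreover have "z \<notin> I" using hit[OF e12(2) ie2] z I e12 by auto
      ultimately obtain k where k: "k \<in> I" "z = p k" unfolding B_def by auto
      then have ki: "k \<noteq> i" using \<open>z \<notin> B\<close> unfolding B_def by auto
      have "D k \<subseteq> D i"
      proof
        fix e assume "e \<in> D k"
        then have "e \<in> E" "z \<notin> e" using pI(2)[OF k(1)] k(2) unfolding D_def by auto
        then show "e \<in> D i" using hit[of e] z unfolding D_def by auto
      qed
      moreover have "D k \<noteq> D i" using dist[OF k(1) i ki] unfolding D_def by blast
      ultimately have "card (D k) < card (D i)"
        using fE unfolding D_def by (intro psubset_card_mono) auto
      then show False using mn[OF k(1)] by simp
    qed
    ultimately have M2: "2 \<le> card M" using M(3) by simp
    then have "M \<noteq> {}" by auto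
    then obtain g1 where g1: "g1 \<in> M" by blast
    have "M \<noteq> {g1}" using M2 by auto
    then obtain g2 where g2: "g2 \<in> M" "g2 \<noteq> g1" using g1 by blast
    obtain f1 where f1: "f1 \<in> E" "i \<notin> f1" "g1 = f1 - B" using M(1) g1 unfolding set_minor_def by auto
    obtain f2 where f2: "f2 \<in> E" "i \<notin> f2" "g2 = f2 - B" using M(1) g2(1) unfolding set_minor_def by auto
    have disj: "g1 \<inter> g2 = {}" using M(2) g1 g2 unfolding disjoint_def by auto
    \<comment> \<open>Each of \<open>f1\<close> and \<open>f2\<close> contains exactly one of
      \<open>k\<close> and \<open>p k\<close>, and neither vertex is in both, since the two edges
      are disjoint outside \<open>B\<close>.\<close>
    have xor: "(k \<in> f1) \<noteq> (k \<in> f2)" if k: "k \<in> I" "k \<noteq> i" for k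
    proof -
      have "\<not> (k \<in> f1 \<and> k \<in> f2)" using disj kB[OF k(1)] f1(3) f2(3) by blast
      moreover have "\<not> (p k \<in> f1 \<and> p k \<in> f2)" using disj pkB[OF k] f1(3) f2(3) by blast
      ultimately show ?thesis using pI(2)[OF k(1) f1(1)] pI(2)[OF k(1) f2(1)] by blast
    qed
    \<comment> \<open>At \<open>i\<close> only \<open>e1\<close> counts; at any other vertex of
      \<open>I\<close> exactly one of \<open>f1\<close> and \<open>f2\<close> cancels it.\<close>
    define c :: "'a set \<Rightarrow> int" where "c e = of_bool (e = e1) - of_bool (e = f1) - of_bool (e = f2)" for e
    have "(\<Sum>e\<in>E. c e * of_bool (j \<in> e)) = of_bool (j = i)" if j: "j \<in> I" for j
    proof -
      have "(\<Sum>e\<in>E. c e * of_bool (j \<in> e)) = of_bool (j \<in> e1) - of_bool (j \<in> f1) - of_bool (j \<in> f2)"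
        unfolding c_def left_diff_distrib sum_subtractf single[OF e12(1)] single[OF f1(1)] single[OF f2(1)] ..
      also have "\<dots> = of_bool (j = i)"
        using xor[OF j] j I f1(2) f2(2) by (cases "j = i"; cases "j \<in> f1"; cases "j \<in> f2") auto
      finally show ?thesis .
    qed
    then show ?thesis using i by blast
  qed
qed

text \<open>Split off a vertex \<open>i\<close> isolated by some combination, treat the other
  vertices by induction, and clear the entry at \<open>i\<close> with a multiple of that
  combination.\<close>

lemma unit_combinations:
  fixes X :: "'a set"
  assumes X: "finite X" and E: "E \<subseteq> Pow X" and packs: "packs X E"
    and e12: "e1 \<in> E" "e2 \<in> E" "e1 \<inter> e2 = {}"
    and anti: "\<And>v. v \<in> X \<Longrightarrow> \<exists>y\<in>X. \<forall>e\<in>E. v \<in> e \<longleftrightarrow> y \<notin> e"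
    and I: "I \<subseteq> e1"
    and dist: "\<And>i j. i \<in> I \<Longrightarrow> j \<in> I \<Longrightarrow> i \<noteq> j \<Longrightarrow> \<exists>e\<in>E. (i \<in> e) \<noteq> (j \<in> e)"
    and k: "k \<in> I"
  shows "\<exists>c :: 'a set \<Rightarrow> int. \<forall>j\<in>I. (\<Sum>e\<in>E. c e * of_bool (j \<in> e)) = of_bool (j = k)"
  using I dist k
proof (induction "card I" arbitrary: I k rule: less_induct)
  case less
  have fI: "finite I" using less.prems(1) e12(1) E X by (meson PowD finite_subset subsetD)
  have "I \<noteq> {}" using less.prems(3) by blast
  from isolating_combination[OF X E packs e12 anti less.prems(1) this less.prems(2)]
  obtain i and c :: "'a set \<Rightarrow> int" where i: "i \<in> I"
    and c: "\<And>j. j \<in> I \<Longrightarrow> (\<Sum>e\<in>E. c e * of_bool (j \<in> e)) = of_bool (j = i)" by blast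
  show ?case
  proof (cases "k = i")
    case True
    then show ?thesis using c by blast
  next
    case False
    have "\<exists>b :: 'a set \<Rightarrow> int. \<forall>j\<in>I - {i}. (\<Sum>e\<in>E. b e * of_bool (j \<in> e)) = of_bool (j = k)"
    proof (rule less.hyps)
      show "card (I - {i}) < card I" using fI i by (rule card_Diff1_less)
      show "I - {i} \<subseteq> e1" "k \<in> I - {i}" using less.prems(1,3) False by auto
      show "\<exists>e\<in>E. (a \<in> e) \<noteq> (b \<in> e)" if "a \<in> I - {i}" "b \<in> I - {i}" "a \<noteq> b" for a b
        using less.prems(2)[of a b] that by simp
    qed
    then obtain b :: "'a set \<Rightarrow> int"
      where b: "\<And>j. j \<in> I - {i} \<Longrightarrow> (\<Sum>e\<in>E. b e * of_bool (j \<in> e)) = of_bool (j = k)"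
      by blast
    define s where "s = (\<Sum>e\<in>E. b e * of_bool (i \<in> e))"
    have "(\<Sum>e\<in>E. (b e - s * c e) * of_bool (j \<in> e)) = of_bool (j = k)" if j: "j \<in> I" for j
    proof -
      have "(\<Sum>e\<in>E. (b e - s * c e) * of_bool (j \<in> e))
          = (\<Sum>e\<in>E. b e * of_bool (j \<in> e)) - s * (\<Sum>e\<in>E. c e * of_bool (j \<in> e))"
        by (simp add: left_diff_distrib sum_subtractf sum_distrib_left mult.assoc)
      also have "\<dots> = of_bool (j = k)"
        unfolding c[OF j] using b[of j] j False by (cases "j = i") (auto simp: s_def)
      finally show ?thesis .
    qed
    then show ?thesis by (intro exI[of _ "\<lambda>e. b e - s * c e"]) blast
  qed
qed

section \<open>Minors and rank of integral matrices\<close>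

text \<open>A repeated column gives determinant 0. Otherwise the matrix is the transpose of a
  submatrix with its rows permuted, and its determinant is an actual minor up to sign.\<close>

lemma det_chosen_columns_dvd:
  fixes B :: "int mat"
  assumes I: "I \<subseteq> {..<dim_row B}" "card I = r" and f: "\<And>i. i < r \<Longrightarrow> f i < dim_col B"
    and g: "\<And>J. J \<subseteq> {..<dim_col B} \<Longrightarrow> card J = r \<Longrightarrow> g dvd det (submatrix B I J)"
  shows "g dvd det (mat r r (\<lambda>(i, a). B $$ (pick I a, f i)))" (is "_ dvd det ?M")
proof (cases "inj_on f {0..<r}")
  case False
  then obtain i j where ij: "i < r" "j < r" "i \<noteq> j" "f i = f j" by (auto simp: inj_on_def)
  then have "row ?M i = row ?M j" by (intro eq_vecI) auto
  then have "det ?M = 0" using ij by (intro det_identical_rows[of ?M r i j]) auto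
  then show ?thesis by simp
next
  case True
  define J where "J = f ` {0..<r}"
  have J: "J \<subseteq> {..<dim_col B}" "card J = r" "finite J"
    using f True unfolding J_def by (auto simp: card_image)
  define S where "S = submatrix B I J"
  have dims: "card {i. i < dim_row B \<and> i \<in> I} = r" "card {j. j < dim_col B \<and> j \<in> J} = r"
  proof -
    have "{i. i < dim_row B \<and> i \<in> I} = I" "{j. j < dim_col B \<and> j \<in> J} = J" using I J by auto
    then show "card {i. i < dim_row B \<and> i \<in> I} = r" "card {j. j < dim_col B \<and> j \<in> J} = r"
      using I J by auto
  qed
  have S: "S \<in> carrier_mat r r" unfolding S_def carrier_mat_def by (simp add: dim_submatrix dims)
  \<comment> \<open>\<open>\<sigma> i\<close> is the position of column \<open>f i\<close> in the
    increasing order used by \<open>submatrix\<close>; outside the index range it is the identity,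
    as \<open>permutes\<close> demands.\<close>
  define \<sigma> where "\<sigma> i = (if i < r then card {a \<in> J. a < f i} else i)" for i
  have fJ: "f i \<in> J" if "i < r" for i using that unfolding J_def by auto
  have pick: "pick J (\<sigma> i) = f i" if "i < r" for i
    using pick_card_in_set[OF fJ[OF that]] that unfolding \<sigma>_def by simp
  have \<sigma>_lt: "\<sigma> i < r" if "i < r" for i
  proof -
    have "{a \<in> J. a < f i} \<subset> J" using fJ[OF that] by auto
    then show ?thesis using psubset_card_mono[OF J(3)] J(2) that unfolding \<sigma>_def by auto
  qed
  have "inj_on \<sigma> {0..<r}"
  proof (rule inj_onI)
    fix i j assume ij: "i \<in> {0..<r}" "j \<in> {0..<r}" "\<sigma> i = \<sigma> j"
    then have "f i = f j" using pick[of i] pick[of j] by simp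
    then show "i = j" using True ij(1,2) by (simp add: inj_onD)
  qed
  moreover have "\<sigma> ` {0..<r} \<subseteq> {0..<r}" using \<sigma>_lt by auto
  ultimately have "bij_betw \<sigma> {0..<r} {0..<r}"
    by (simp add: bij_betw_def endo_inj_surj)
  then have perm: "\<sigma> permutes {0..<r}" by (rule bij_imp_permutes) (auto simp: \<sigma>_def)
  have "?M = mat r r (\<lambda>(i, a). S\<^sup>T $$ (\<sigma> i, a))"
  proof (rule eq_matI)
    fix i a assume "i < dim_row (mat r r (\<lambda>(i, a). S\<^sup>T $$ (\<sigma> i, a)))"
      "a < dim_col (mat r r (\<lambda>(i, a). S\<^sup>T $$ (\<sigma> i, a)))"
    then have "i < r" "a < r" by auto
    then show "?M $$ (i, a) = mat r r (\<lambda>(i, a). S\<^sup>T $$ (\<sigma> i, a)) $$ (i, a)"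
      using S \<sigma>_lt[of i] pick[of i] by (simp add: S_def submatrix_index dims)
  qed auto
  then have "det ?M = signof \<sigma> * det S\<^sup>T"
    using det_permute_rows[OF _ perm, of "S\<^sup>T"] S by simp
  then have "det ?M = signof \<sigma> * det S" using det_transpose[OF S] by simp
  then show ?thesis using g[OF J(1,2)] unfolding S_def by simp
qed

text \<open>On the rows \<open>I\<close> the unit vectors are integral combinations of the columns.
  Expanding the determinant of the identity matrix by multilinearity writes 1 as an integral
  combination of determinants of chosen columns, all divisible by \<open>g\<close>.\<close>

lemma common_divisor_of_minors_dvd_one:
  fixes B :: "int mat"
  assumes I: "I \<subseteq> {..<dim_row B}" "card I = r"
    and unit: "\<And>i. i \<in> I \<Longrightarrow>
      \<exists>c. \<forall>k\<in>I. (\<Sum>j<dim_col B. c j * B $$ (k, j)) = of_bool (k = i)"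
    and g: "\<And>J. J \<subseteq> {..<dim_col B} \<Longrightarrow> card J = r \<Longrightarrow> g dvd det (submatrix B I J)"
  shows "g dvd 1"
proof -
  let ?q = "dim_col B"
  have pI: "pick I i \<in> I" if "i < r" for i using pick_in_set_le that I(2) by blast
  have pick_eq: "pick I i = pick I j \<longleftrightarrow> i = j" if "i < r" "j < r" for i j
    using pick_mono_le[of i I j] pick_mono_le[of j I i] that I(2) by (metis less_irrefl linorder_neqE_nat)
  have "\<forall>i\<in>I. \<exists>c. \<forall>k\<in>I. (\<Sum>j<?q. c j * B $$ (k, j)) = of_bool (k = i)" using unit by blast
  from bchoice[OF this] obtain c
    where c: "\<And>i k. i \<in> I \<Longrightarrow> k \<in> I \<Longrightarrow> (\<Sum>j<?q. c i j * B $$ (k, j)) = of_bool (k = i)" by blast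
  \<comment> \<open>The columns of \<open>B\<close> on the rows \<open>I\<close>, to be used as row
    vectors because the expansion of \<open>det\<close> is in terms of rows.\<close>
  define v where "v j = vec r (\<lambda>a. B $$ (pick I a, j))" for j
  define w where "w i j = c (pick I i) j \<cdot>\<^sub>v v j" for i j
  have v: "v j \<in> carrier_vec r" and w: "w i j \<in> carrier_vec r" for i j
    unfolding v_def w_def by auto
  \<comment> \<open>The choices of one column for each row; fixing the identity outside
    \<open>{0..<r}\<close> makes this set finite.\<close>
  let ?F = "{f. (\<forall>i\<in>{0..<r}. f i \<in> {..<?q}) \<and> (\<forall>i. i \<notin> {0..<r} \<longrightarrow> f i = i)}"
  have "mat\<^sub>r r r (\<lambda>i. finsum_vec TYPE(int) r (w i) {..<?q}) = 1\<^sub>m r"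
  proof (rule eq_matI)
    fix i a assume "i < dim_row (1\<^sub>m r :: int mat)" "a < dim_col (1\<^sub>m r :: int mat)"
    then have ia: "i < r" "a < r" by auto
    have "mat\<^sub>r r r (\<lambda>i. finsum_vec TYPE(int) r (w i) {..<?q}) $$ (i, a) = (\<Sum>j<?q. w i j $ a)"
      using ia w by (simp add: index_finsum_vec)
    also have "\<dots> = (\<Sum>j<?q. c (pick I i) j * B $$ (pick I a, j))"
      using ia by (simp add: w_def v_def)
    also have "\<dots> = of_bool (pick I a = pick I i)" using c pI ia by blast
    finally show "mat\<^sub>r r r (\<lambda>i. finsum_vec TYPE(int) r (w i) {..<?q}) $$ (i, a) = 1\<^sub>m r $$ (i, a)"
      using ia pick_eq by auto
  qed auto
  then have "1 = det (mat\<^sub>r r r (\<lambda>i. finsum_vec TYPE(int) r (w i) {..<?q}))" by simp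
  also have "\<dots> = (\<Sum>f\<in>?F. det (mat\<^sub>r r r (\<lambda>i. w i (f i))))"
    using w by (intro det_linear_rows_sum) auto
  also have "\<dots> = (\<Sum>f\<in>?F. (\<Prod>i\<in>{0..<r}. c (pick I i) (f i)) * det (mat\<^sub>r r r (\<lambda>i. v (f i))))"
    unfolding w_def using v by (intro sum.cong refl det_rows_mul) auto
  finally have one: "1 = (\<Sum>f\<in>?F. (\<Prod>i\<in>{0..<r}. c (pick I i) (f i)) * det (mat\<^sub>r r r (\<lambda>i. v (f i))))" .
  have "g dvd det (mat\<^sub>r r r (\<lambda>i. v (f i)))" if f: "f \<in> ?F" for f
  proof -
    have "mat\<^sub>r r r (\<lambda>i. v (f i)) = mat r r (\<lambda>(i, a). B $$ (pick I a, f i))"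
      by (rule eq_matI) (auto simp: v_def)
    moreover have "g dvd det (mat r r (\<lambda>(i, a). B $$ (pick I a, f i)))"
      by (rule det_chosen_columns_dvd[OF I _ g]) (use f in auto)
    ultimately show ?thesis by simp
  qed
  then show ?thesis unfolding one by (intro dvd_sum dvd_mult) blast
qed

text \<open>The matrix is a sum of \<open>q\<close> matrices of rank at most 1, and the rank is
  subadditive.\<close>

lemma rank_sum_of_products_le:
  fixes f g :: "nat \<Rightarrow> nat \<Rightarrow> 'b::field"
  shows "vec_space.rank n (mat n nc (\<lambda>(i, j). \<Sum>k<q. f k i * g k j)) \<le> q"
proof (induction q)
  case 0
  have "mat n nc (\<lambda>(i, j). \<Sum>k<0::nat. f k i * g k j) = 0\<^sub>m n nc" by (rule eq_matI) auto
  then show ?case by (simp only: vec_space.rank_0I)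
next
  case (Suc q)
  let ?A = "mat n nc (\<lambda>(i, j). \<Sum>k<q. f k i * g k j)" and ?B = "mat n nc (\<lambda>(i, j). f q i * g q j)"
  have "mat n nc (\<lambda>(i, j). \<Sum>k<Suc q. f k i * g k j) = ?A + ?B" by (rule eq_matI) auto
  moreover have "vec_space.rank n (?A + ?B) \<le> vec_space.rank n ?A + vec_space.rank n ?B"
    by (rule vec_space.rank_subadditive) auto
  moreover have "vec_space.rank n ?B \<le> 1"
    by (rule vec_space.rank_le_1_product_entries[of _ n nc "f q" "g q"]) auto
  ultimately show ?case using Suc.IH by simp
qed

section \<open>Certificates for the rank and for the common divisor of minors\<close>

text \<open>\<open>Delta r B\<close> divides every minor on the rows \<open>I\<close>, the zero ones
  trivially, and therefore divides 1.\<close>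

lemma Delta_eq_1I:
  assumes "I \<subseteq> {..<dim_row B}" "card I = r"
    and "\<And>i. i \<in> I \<Longrightarrow> \<exists>c. \<forall>k\<in>I. (\<Sum>j<dim_col B. c j * B $$ (k, j)) = of_bool (k = i)"
  shows "Delta r B = 1"
proof -
  have "Delta r B dvd 1"
  proof (rule common_divisor_of_minors_dvd_one[OF assms])
    fix J assume J: "J \<subseteq> {..<dim_col B}" "card J = r"
    show "Delta r B dvd det (submatrix B I J)"
    proof (cases "det (submatrix B I J) = 0")
      case False
      then have "det (submatrix B I J) \<in> subdeterminants r B - {0}"
        using assms(1,2) J unfolding subdeterminants_def by blast
      then show ?thesis unfolding Delta_def by (rule Gcd_dvd)
    qed simp
  qed
  then show ?thesis unfolding Delta_def by simp
qed

lemma submatrix_map_mat: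
  "submatrix (map_mat h A) I J = map_mat h (submatrix A I J)"
  by (rule eq_matI) (auto simp: submatrix_def pick_le)

lemma int_mat_rank_ge:
  assumes "I \<subseteq> {..<dim_row A}" "card I = r"
    and "\<And>i. i \<in> I \<Longrightarrow> \<exists>c. \<forall>k\<in>I. (\<Sum>j<dim_col A. c j * A $$ (k, j)) = of_bool (k = i)"
  shows "r \<le> int_mat_rank A"
proof -
  \<comment> \<open>Used with the divisor 0: if all minors on these rows vanished, 0 would divide
    1.\<close>
  obtain J where J: "J \<subseteq> {..<dim_col A}" "card J = r" "det (submatrix A I J) \<noteq> 0"
    using common_divisor_of_minors_dvd_one[OF assms, of 0] by auto
  have "det (submatrix (map_mat rat_of_int A) I J) \<noteq> 0"
    using J(3) unfolding submatrix_map_mat of_int_hom.hom_det by simp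
  moreover have "map_mat rat_of_int A \<in> carrier_mat (dim_row A) (dim_col A)" by simp
  ultimately have "card {j. j < dim_col A \<and> j \<in> J} \<le> int_mat_rank A"
    unfolding int_mat_rank_def by (intro vec_space.rank_gt_minor)
  moreover have "{j. j < dim_col A \<and> j \<in> J} = J" using J(1) by auto
  ultimately show ?thesis using J(2) by simp
qed

lemma int_mat_rank_le:
  assumes "\<And>i j. i < dim_row A \<Longrightarrow> j < dim_col A \<Longrightarrow> A $$ (i, j) = (\<Sum>k<q. f k i * g k j)"
  shows "int_mat_rank A \<le> q"
proof -
  have "map_mat rat_of_int A = mat (dim_row A) (dim_col A)
      (\<lambda>(i, j). \<Sum>k<q. rat_of_int (f k i) * rat_of_int (g k j))"
    by (rule eq_matI) (auto simp: assms)
  then show ?thesis unfolding int_mat_rank_def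
    by (simp only: rank_sum_of_products_le)
qed

section \<open>The incidence matrix\<close>

lemma distinct_representatives:
  assumes "finite A"
  obtains R where "R \<subseteq> A"
    "\<And>x. x \<in> A \<Longrightarrow> \<exists>y\<in>R. \<forall>e\<in>E. x \<in> e \<longleftrightarrow> y \<in> e"
    "\<And>x y. x \<in> R \<Longrightarrow> y \<in> R \<Longrightarrow> x \<noteq> y \<Longrightarrow> \<exists>e\<in>E. (x \<in> e) \<noteq> (y \<in> e)"
proof -
  define row where "row x = {e \<in> E. x \<in> e}" for x
  define R where "R = inv_into A row ` row ` A"
  have row_inv: "row (inv_into A row s) = s" if "s \<in> row ` A" for s using that by (rule f_inv_into_f)
  show thesis
  proof (rule that)
    show "R \<subseteq> A" unfolding R_def by (auto intro: inv_into_into)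
    show "\<exists>y\<in>R. \<forall>e\<in>E. x \<in> e \<longleftrightarrow> y \<in> e" if "x \<in> A" for x
    proof
      show "inv_into A row (row x) \<in> R" using that unfolding R_def by blast
      show "\<forall>e\<in>E. x \<in> e \<longleftrightarrow> inv_into A row (row x) \<in> e"
        using row_inv[of "row x"] that unfolding row_def by blast
    qed
    show "\<exists>e\<in>E. (x \<in> e) \<noteq> (y \<in> e)" if xy: "x \<in> R" "y \<in> R" "x \<noteq> y" for x y
    proof -
      obtain s t where "x = inv_into A row s" "y = inv_into A row t" "s \<in> row ` A" "t \<in> row ` A"
        using xy unfolding R_def by blast
      then have "row x \<noteq> row y" using row_inv xy(3) by metis
      then show ?thesis unfolding row_def by blast
    qed
  qed
qed

lemma covering_number_two:
  assumes X: "finite X" and cov: "covering_number X E = 2" and ne: "{} \<notin> E" and E: "E \<subseteq> Pow X"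
  shows "\<And>b. vertex_cover X E b \<Longrightarrow> 2 \<le> card b"
    and "\<exists>b. vertex_cover X E b \<and> card b = 2"
proof -
  let ?C = "{card C | C. vertex_cover X E C}"
  have "?C \<subseteq> card ` Pow X" unfolding vertex_cover_def by auto
  then have fin: "finite ?C" by (rule finite_subset) (simp add: X)
  show "2 \<le> card b" if "vertex_cover X E b" for b
    using Min_le[OF fin, of "card b"] that cov unfolding covering_number_def by auto
  have "vertex_cover X E X" using E ne unfolding vertex_cover_def by (auto simp: Int_absorb1 Pow_def)
  then have "?C \<noteq> {}" by blast
  from Min_in[OF fin this] show "\<exists>b. vertex_cover X E b \<and> card b = 2"
    using cov unfolding covering_number_def by auto
qed

text \<open>Disjoint edges use different vertices of a cover of size 2, so \<open>M\<close> has at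
  most two members. An empty \<open>M\<close> makes \<open>X\<close> empty, and a single member
  makes \<open>X\<close> the only edge; either way there is a cover with fewer than two
  vertices.\<close>

lemma complementary_edges:
  assumes clutter: "clutter X E" and ne: "{} \<notin> E"
    and pm: "perfect_matching X E M" and cov: "covering_number X E = 2"
  obtains e1 e2 where "e1 \<in> E" "e2 \<in> E" "e1 \<inter> e2 = {}" "e1 \<union> e2 = X"
proof -
  have X: "finite X" and E: "E \<subseteq> Pow X" and anti: "\<And>e f. e \<in> E \<Longrightarrow> f \<in> E \<Longrightarrow> e \<subseteq> f \<Longrightarrow> e = f"
    using clutter unfolding clutter_def by auto
  note ge2 = covering_number_two(1)[OF X cov ne E]
  obtain C where C: "vertex_cover X E C" "card C = 2" using covering_number_two(2)[OF X cov ne E] by blast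
  have M: "M \<subseteq> E" "disjoint M" "\<Union>M = X" using pm unfolding perfect_matching_def by auto
  have "\<forall>e\<in>M. \<exists>x. x \<in> C \<inter> e" using C(1) M(1) unfolding vertex_cover_def by blast
  from bchoice[OF this] obtain h where h: "\<And>e. e \<in> M \<Longrightarrow> h e \<in> C \<inter> e" by blast
  have "inj_on h M"
  proof (rule inj_onI)
    fix e f assume "e \<in> M" "f \<in> M" "h e = h f"
    then have "h e \<in> e \<inter> f" using h by fastforce
    then show "e = f" using M(2) \<open>e \<in> M\<close> \<open>f \<in> M\<close> unfolding disjoint_def by blast
  qed
  moreover have "finite C" using C(2) by (intro card_ge_0_finite) simp
  ultimately have "card M \<le> card C" using h by (intro card_inj_on_le) auto
  moreover have "card M \<noteq> 0"
  proof
    assume "card M = 0"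
    moreover have "finite M" using M(1) E X by (meson finite_Pow_iff finite_subset)
    ultimately have "X = {}" using M(3) by simp
    then have "E = {}" using E ne by auto
    then have "vertex_cover X E {}" unfolding vertex_cover_def by simp
    then show False using ge2[of "{}"] by simp
  qed
  moreover have "card M \<noteq> 1"
  proof
    assume "card M = 1"
    then obtain e where e: "M = {e}" by (auto simp: card_1_singleton_iff)
    then have eX: "e = X" "e \<in> E" using M by auto
    then have all: "f = X" if "f \<in> E" for f using anti[OF that, of e] that E by blast
    have "X \<noteq> {}" using eX ne by auto
    then obtain x where "x \<in> X" by blast
    then have "vertex_cover X E {x}" unfolding vertex_cover_def by (auto dest: all)
    then show False using ge2[of "{x}"] by simp
  qed
  ultimately have "card M = 2" using C(2) by simp
  then obtain e1 e2 where e: "M = {e1, e2}" "e1 \<noteq> e2" by (auto simp: card_2_iff)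
  show thesis
    by (rule that[of e1 e2]) (use e M in \<open>auto simp: disjoint_def\<close>)
qed

lemma incidence_matrix_simps:
  "dim_row (incidence_matrix xs es) = length xs" "dim_col (incidence_matrix xs es) = length es"
  "i < length xs \<Longrightarrow> j < length es \<Longrightarrow> incidence_matrix xs es $$ (i, j) = of_bool (xs ! i \<in> es ! j)"
  by (simp_all add: incidence_matrix_def)

lemma append_ones_row_simps:
  "dim_row (append_ones_row A) = Suc (dim_row A)" "dim_col (append_ones_row A) = dim_col A"
  "i < dim_row A \<Longrightarrow> j < dim_col A \<Longrightarrow> append_ones_row A $$ (i, j) = A $$ (i, j)"
  by (simp_all add: append_ones_row_def append_rows_def)

lemma sum_nth_set:
  assumes "distinct es"
  shows "(\<Sum>j<length es. F (es ! j)) = (\<Sum>e\<in>set es. F e)"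
  by (rule sum.reindex_bij_betw[OF bij_betw_nth[OF assms refl refl]])

theorem theorem2p3p1:
  fixes X :: "'a set" and E :: "'a set set" and d r :: nat
    and xs :: "'a list" and es :: "'a set list"
  assumes "clutter X E"
    and "uniform d E"
    and "\<forall>x\<in>X. \<not> isolated E x"
    and "distinct xs" and "set xs = X"
    and "distinct es" and "set es = E"
    and "\<exists>M. perfect_matching X E M"
    and "packing_property TYPE('k::field) X E"
    and "covering_number X E = 2"
    and "int_mat_rank (incidence_matrix xs es) = r"
  shows "Delta r (append_ones_row (incidence_matrix xs es)) = 1"
proof -
  let ?A = "incidence_matrix xs es"
  have X: "finite X" and E: "E \<subseteq> Pow X" using assms(1) unfolding clutter_def by auto
  show ?thesis
  proof (cases "{} \<in> E")
    \<comment> \<open>Then \<open>X\<close> is empty, so the matrix has no rows,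
      \<open>r = 0\<close>, and the empty minor equals 1.\<close>
    case True
    then have "E = {{}}" using assms(1) unfolding clutter_def by blast
    then have "X = {}" using assms(3) unfolding isolated_def by auto
    then have "int_mat_rank ?A \<le> 0"
      using assms(5) by (intro int_mat_rank_le[where f = "\<lambda>_ _. 0" and g = "\<lambda>_ _. 0"])
        (simp add: incidence_matrix_simps)
    then have "r = 0" using assms(11) by simp
    then show ?thesis by (intro Delta_eq_1I[of "{}"]) auto
  next
    case False
    note packs = packing_property_imp_packs[OF X E assms(9)]
    note cov = covering_number_two(1)[OF X assms(10) False E]
    obtain e1 e2 where e: "e1 \<in> E" "e2 \<in> E" "e1 \<inter> e2 = {}" "e1 \<union> e2 = X"
      using assms(8) complementary_edges[OF assms(1) False _ assms(10)] by blast
    have fe: "finite e1" "finite e2" using e(4) X by auto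
    have "card e1 = d" "card e2 = d" using assms(2) e unfolding uniform_def by auto
    then have cX: "card X = 2 * d" using card_Un_disjoint[OF fe e(3)] e(4) by simp
    have "e1 \<noteq> {}" using e(1) False by blast
    then have d: "0 < d" using \<open>card e1 = d\<close> fe(1) by (auto simp: card_gt_0_iff)
    have anti: "\<exists>y\<in>X. \<forall>e\<in>E. v \<in> e \<longleftrightarrow> y \<notin> e" if "v \<in> X" for v
      by (rule antipodal_vertex[OF X E packs assms(2) d cX cov that])
    \<comment> \<open>\<open>R\<close> represents the distinct rows of vertices in
      \<open>e1\<close>; by antipodality the rows outside \<open>e1\<close> are complements of
      these.\<close>
    obtain R where R: "R \<subseteq> e1"
      and rep: "\<And>x. x \<in> e1 \<Longrightarrow> \<exists>y\<in>R. \<forall>e\<in>E. x \<in> e \<longleftrightarrow> y \<in> e"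
      and dist: "\<And>x y. x \<in> R \<Longrightarrow> y \<in> R \<Longrightarrow> x \<noteq> y \<Longrightarrow> \<exists>e\<in>E. (x \<in> e) \<noteq> (y \<in> e)"
      by (rule distinct_representatives[OF fe(1), of E]) blast
    have fR: "finite R" using R fe(1) finite_subset by blast
    obtain i0 where i0: "i0 \<in> R" using rep \<open>e1 \<noteq> {}\<close> by blast
    then obtain p0 where p0: "p0 \<in> X" "\<And>e. e \<in> E \<Longrightarrow> i0 \<in> e \<longleftrightarrow> p0 \<notin> e"
      using anti[of i0] R e(4) by blast
    have p0e: "p0 \<notin> e1" "p0 \<in> e2" using p0(2) e i0 R by auto
    \<comment> \<open>The rows of \<open>V\<close> turn out to be a basis of the row space: one
      antipodal row is added, because the rows of \<open>i0\<close> and \<open>p0\<close> sum to the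
      all-ones row.\<close>
    define V where "V = insert p0 R"
    have VX: "V \<subseteq> X" using p0(1) R e(4) unfolding V_def by auto
    have cV: "card V = Suc (card R)" using p0e(1) R fR unfolding V_def by (subst card_insert_disjoint) auto
    have fE: "finite E" using E X finite_subset by blast
    have e2_only: "(\<Sum>f\<in>E. of_bool (f = e2) * of_bool (x \<in> f)) = (of_bool (x \<in> e2) :: int)" for x
    proof -
      have "(\<Sum>f\<in>E. of_bool (f = e2) * of_bool (x \<in> f)) = (\<Sum>f\<in>E. if f = e2 then of_bool (x \<in> e2) else (0 :: int))"
        by (rule sum.cong) auto
      then show ?thesis using fE e(2) by simp
    qed
    have unit: "\<exists>b :: 'a set \<Rightarrow> int. \<forall>x\<in>V. (\<Sum>f\<in>E. b f * of_bool (x \<in> f)) = of_bool (x = t)" if t: "t \<in> V" for t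
    proof (cases "t = p0")
      case True
      \<comment> \<open>The edge \<open>e2\<close> contains \<open>p0\<close> and is disjoint from
        \<open>R\<close>, so on \<open>V\<close> it is the unit vector of \<open>p0\<close>.\<close>
      have "of_bool (x \<in> e2) = (of_bool (x = t) :: int)" if "x \<in> V" for x
        using that True p0e R e(3) unfolding V_def by auto
      then show ?thesis using e2_only by (intro exI[of _ "\<lambda>f. of_bool (f = e2)"]) simp
    next
      case False
      then have tR: "t \<in> R" using t unfolding V_def by simp
      from unit_combinations[OF X E packs e(1,2,3) anti R dist tR]
      obtain c :: "'a set \<Rightarrow> int" where c: "\<And>x. x \<in> R \<Longrightarrow> (\<Sum>f\<in>E. c f * of_bool (x \<in> f)) = of_bool (x = t)"
        by blast
      \<comment> \<open>The entry at \<open>p0\<close>, which is cleared by subtracting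
        \<open>s\<close> times the edge \<open>e2\<close>.\<close>
      define s where "s = (\<Sum>f\<in>E. c f * of_bool (p0 \<in> f))"
      have "(\<Sum>f\<in>E. (c f - s * of_bool (f = e2)) * of_bool (x \<in> f)) = of_bool (x = t)" if x: "x \<in> V" for x
      proof -
        have "(\<Sum>f\<in>E. (c f - s * of_bool (f = e2)) * of_bool (x \<in> f))
            = (\<Sum>f\<in>E. c f * of_bool (x \<in> f)) - s * (\<Sum>f\<in>E. of_bool (f = e2) * of_bool (x \<in> f))"
          by (simp only: left_diff_distrib sum_subtractf sum_distrib_left mult.assoc)
        also have "\<dots> = of_bool (x = t)"
        proof (cases "x = p0")
          case True
          then show ?thesis unfolding e2_only using p0e False by (simp add: s_def)
        next
          case False
          then have "x \<in> R" using x unfolding V_def by simp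
          moreover from this have "x \<notin> e2" using R e(3) by blast
          ultimately show ?thesis unfolding e2_only using c by simp
        qed
        finally show ?thesis .
      qed
      then show ?thesis by (intro exI[of _ "\<lambda>f. c f - s * of_bool (f = e2)"]) blast
    qed
    define I where "I = {i. i < length xs \<and> xs ! i \<in> V}"
    have "bij_betw (\<lambda>i. xs ! i) I V"
      unfolding bij_betw_def
    proof
      show "inj_on ((!) xs) I" unfolding I_def using assms(4) by (auto simp: inj_on_def nth_eq_iff_index_eq)
      have "x \<in> (!) xs ` I" if x: "x \<in> V" for x
      proof -
        have "x \<in> set xs" using x VX assms(5) by blast
        then obtain i where "i < length xs" "x = xs ! i" by (auto simp: in_set_conv_nth)
        then show ?thesis using x unfolding I_def by blast
      qed
      then show "(!) xs ` I = V" unfolding I_def by auto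
    qed
    then have cI: "card I = Suc (card R)" using cV bij_betw_same_card by metis
    have unit_rows: "\<exists>c. \<forall>k\<in>I. (\<Sum>j<length es. c j * ?A $$ (k, j)) = of_bool (k = i)" if i: "i \<in> I" for i
    proof -
      have "xs ! i \<in> V" using i unfolding I_def by simp
      from unit[OF this] obtain b :: "'a set \<Rightarrow> int"
        where b: "\<And>x. x \<in> V \<Longrightarrow> (\<Sum>f\<in>E. b f * of_bool (x \<in> f)) = of_bool (x = xs ! i)" by blast
      have "(\<Sum>j<length es. b (es ! j) * ?A $$ (k, j)) = of_bool (k = i)" if k: "k \<in> I" for k
      proof -
        have "(\<Sum>j<length es. b (es ! j) * ?A $$ (k, j)) = (\<Sum>j<length es. b (es ! j) * of_bool (xs ! k \<in> es ! j))"
          using k unfolding I_def by (intro sum.cong) (auto simp: incidence_matrix_simps)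
        also have "\<dots> = (\<Sum>f\<in>E. b f * of_bool (xs ! k \<in> f))"
          using sum_nth_set[OF assms(6), of "\<lambda>f. b f * of_bool (xs ! k \<in> f)"] assms(7) by simp
        also have "\<dots> = of_bool (xs ! k = xs ! i)" using b k unfolding I_def by simp
        finally show ?thesis using k i assms(4) unfolding I_def by (simp add: nth_eq_iff_index_eq)
      qed
      then show ?thesis by (intro exI[of _ "\<lambda>j. b (es ! j)"]) blast
    qed
    have "Suc (card R) \<le> int_mat_rank ?A"
      by (rule int_mat_rank_ge[OF _ cI]) (use unit_rows in \<open>auto simp: incidence_matrix_simps I_def\<close>)
    \<comment> \<open>Each row equals a row from \<open>R\<close> or the all-ones row minus such a
      row, so \<open>Suc (card R)\<close> vectors span all rows.\<close>
    moreover have "int_mat_rank ?A \<le> Suc (card R)"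
    proof -
      obtain h where h: "bij_betw h {..<card R} R"
        using ex_bij_betw_nat_finite[OF fR] by (auto simp: atLeast0LessThan)
      \<comment> \<open>The flag \<open>s\<close> records whether the row of \<open>x\<close> is the
        complement of the row of \<open>y\<close>.\<close>
      have "\<exists>s y. y \<in> R \<and> (\<forall>f\<in>E. (of_bool (x \<in> f) :: int) = (1 - 2 * of_bool s) * of_bool (y \<in> f) + of_bool s)"
        if x: "x \<in> X" for x
      proof (cases "x \<in> e1")
        case True
        obtain y where "y \<in> R" "\<forall>f\<in>E. x \<in> f \<longleftrightarrow> y \<in> f" using rep[OF True] by blast
        then show ?thesis by (intro exI[of _ False] exI[of _ y]) simp
      next
        case False
        obtain z where z: "z \<in> X" "\<And>f. f \<in> E \<Longrightarrow> x \<in> f \<longleftrightarrow> z \<notin> f" using anti[OF x] by blast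
        then have "z \<in> e1" using e(1) False by blast
        from rep[OF this] obtain y where "y \<in> R" "\<forall>f\<in>E. z \<in> f \<longleftrightarrow> y \<in> f" by blast
        then show ?thesis using z(2) by (intro exI[of _ True] exI[of _ y]) auto
      qed
      then obtain s y where y: "\<And>x. x \<in> X \<Longrightarrow> y x \<in> R"
        and eq: "\<And>x f. x \<in> X \<Longrightarrow> f \<in> E \<Longrightarrow>
          (of_bool (x \<in> f) :: int) = (1 - 2 * of_bool (s x)) * of_bool (y x \<in> f) + of_bool (s x)"
        by metis
      \<comment> \<open>A factorization of the matrix: inner index \<open>k < card R\<close> stands
        for the row of \<open>h k\<close>, and the last index for the all-ones row.\<close>
      define u :: "nat \<Rightarrow> nat \<Rightarrow> int" where "u k i = (if k < card R
        then (1 - 2 * of_bool (s (xs ! i))) * of_bool (h k = y (xs ! i)) else of_bool (s (xs ! i)))" for k i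
      define w :: "nat \<Rightarrow> nat \<Rightarrow> int" where "w k j = (if k < card R then of_bool (h k \<in> es ! j) else 1)" for k j
      have "?A $$ (i, j) = (\<Sum>k<Suc (card R). u k i * w k j)" if "i < length xs" "j < length es" for i j
      proof -
        let ?x = "xs ! i" and ?f = "es ! j"
        have xf: "?x \<in> X" "?f \<in> E" using that assms(5,7) by auto
        have "(\<Sum>k<card R. u k i * w k j) = (\<Sum>k<card R. (1 - 2 * of_bool (s ?x)) * of_bool (h k = y ?x) * of_bool (h k \<in> ?f))"
          by (rule sum.cong) (auto simp: u_def w_def)
        also have "\<dots> = (\<Sum>z\<in>R. (1 - 2 * of_bool (s ?x)) * of_bool (z = y ?x) * of_bool (z \<in> ?f))"
          by (rule sum.reindex_bij_betw[OF h])
        also have "\<dots> = (\<Sum>z\<in>R. if z = y ?x then (1 - 2 * of_bool (s ?x)) * of_bool (y ?x \<in> ?f) else 0)"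
          by (rule sum.cong) auto
        also have "\<dots> = (1 - 2 * of_bool (s ?x)) * of_bool (y ?x \<in> ?f)" using fR y[OF xf(1)] by simp
        finally have rows: "(\<Sum>k<card R. u k i * w k j) = (1 - 2 * of_bool (s ?x)) * of_bool (y ?x \<in> ?f)" .
        have "u (card R) i * w (card R) j = of_bool (s ?x)" by (simp add: u_def w_def)
        then show ?thesis
          unfolding sum.lessThan_Suc rows incidence_matrix_simps(3)[OF that] eq[OF xf] by (simp only:)
      qed
      then show ?thesis by (intro int_mat_rank_le) (simp add: incidence_matrix_simps)
    qed
    ultimately have "r = Suc (card R)" using assms(11) by simp
    show ?thesis
    proof (rule Delta_eq_1I)
      show "I \<subseteq> {..<dim_row (append_ones_row ?A)}"
        by (auto simp: append_ones_row_simps incidence_matrix_simps I_def)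
      show "card I = r" using cI \<open>r = Suc (card R)\<close> by simp
      fix i assume "i \<in> I"
      from unit_rows[OF this] obtain c
        where c: "\<And>k. k \<in> I \<Longrightarrow> (\<Sum>j<length es. c j * ?A $$ (k, j)) = of_bool (k = i)" by blast
      \<comment> \<open>The rows in \<open>I\<close> precede the appended one, so their entries are
        those of \<open>?A\<close> and the unit combinations carry over.\<close>
      have "(\<Sum>j<dim_col (append_ones_row ?A). c j * append_ones_row ?A $$ (k, j)) = of_bool (k = i)"
        if k: "k \<in> I" for k
        using c[OF k] k by (simp add: append_ones_row_simps incidence_matrix_simps(1,2) I_def)
      then show "\<exists>c. \<forall>k\<in>I. (\<Sum>j<dim_col (append_ones_row ?A). c j * append_ones_row ?A $$ (k, j)) = of_bool (k = i)"
        by blast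
    qed
  qed
qed

end
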